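(* Let $\pi_{SI}$ be any protocol for $\mathsf{Set\text{-}Int}$ on instances $(A,B)$ sampled from $\mathcal{D}_{SI}$, and let $\Pi_{SI}$ denote its transcript (together with its public randomness). If $\mathbb{E}_{\Pi_{SI}}\big[\|\mathrm{dist}(T \mid \Pi_{SI}) - \mathcal{U}_{[n]}\|_{tvd}\big] \geq \varepsilon$, i.e., $\pi_{SI}$ $\varepsilon$-solves $\mathsf{Set\text{-}Int}$, then the internal information cost of $\pi_{SI}$ on $\mathcal{D}_{SI}$ is $\mathrm{IC}(\pi_{SI}, \mathcal{D}_{SI}) = \Omega(\varepsilon^2 \cdot n)$.
   Context: $\mathsf{Set\text{-}Int}$: Alice holds $A = (a_1,\dots,a_n) \in \{0,1\}^n$ and Bob holds $B = (b_1,\dots,b_n)\in\{0,1\}^n$ (characteristic vectors of subsets of $[n]$) with the promise that there is a unique index $t$ (the target element) with $(a_t,b_t) = (1,1)$. Distribution $\mathcal{D}_{SI}$: let $\mu$ be uniform on $\{(0,0),(0,1),(1,0)\}$; sample each $(a_i,b_i)$ independently from $\mu$, then pick $t \in [n]$ uniformly at random and set $(a_t,b_t) = (1,1)$. $T$ is the random variable for the target element, $\mathcal{U}_{[n]}$ the uniform distribution on $[n]$, and $\|\cdot\|_{tvd}$ the total variation distance. Protocols may use public and private randomness. The internal information cost is $\mathrm{IC}(\pi,\mathcal{D}) = I(\Pi; A \mid B) + I(\Pi; B \mid A)$ where $\Pi$ is the transcript concatenated with the public randomness and $(A,B) \sim \mathcal{D}$. *)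

theory Defs
  imports "HOL-Probability.Probability"
begin

section \<open>Two-party protocols with public and private randomness\<close>

text \<open>
  Random strings are infinite bit strings. Their laws are arbitrary probability measures on this
  type (with any sigma-algebra), so fair coin flips, discrete laws and continuous laws are all
  covered.
\<close>
type_synonym tape = "nat \<Rightarrow> bool"

text \<open>
  A communication tree: at an inner node its owner sends one bit, which is a function of the owner's
  input and private random string (and of the bits sent so far, which the node itself encodes). The
  left subtree is entered on the bit True.
\<close>
datatype ('x, 'y) comm_tree =
    Halt
  | Alice "'x \<Rightarrow> tape \<Rightarrow> bool" "('x, 'y) comm_tree" "('x, 'y) comm_tree"
  | Bob "'y \<Rightarrow> tape \<Rightarrow> bool" "('x, 'y) comm_tree" "('x, 'y) comm_tree"

fun messages :: "('x, 'y) comm_tree \<Rightarrow> 'x \<Rightarrow> 'y \<Rightarrow> tape \<Rightarrow> tape \<Rightarrow> bool list" where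
  "messages Halt x y ra rb = []"
| "messages (Alice f l r) x y ra rb =
    f x ra # messages (if f x ra then l else r) x y ra rb"
| "messages (Bob g l r) x y ra rb =
    g y rb # messages (if g y rb then l else r) x y ra rb"

text \<open>The public random string selects the whole tree, hence every bit may depend on it.\<close>
record ('x, 'y) protocol =
  public_law :: "tape measure"
  alice_law :: "tape measure"
  bob_law :: "tape measure"
  tree :: "tape \<Rightarrow> ('x, 'y) comm_tree"

definition is_protocol :: "('x, 'y) protocol \<Rightarrow> bool" where
  "is_protocol \<pi> \<longleftrightarrow>
    prob_space (public_law \<pi>) \<and> prob_space (alice_law \<pi>) \<and> prob_space (bob_law \<pi>) \<and>
    (\<forall>x y. (\<lambda>(r, ra, rb). messages (tree \<pi> r) x y ra rb)
       \<in> public_law \<pi> \<Otimes>\<^sub>M alice_law \<pi> \<Otimes>\<^sub>M bob_law \<pi> \<rightarrow>\<^sub>M count_space UNIV)"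

text \<open>
  An outcome of an execution is \<open>((x, y), r, ra, rb)\<close>: the inputs, the public string and the two
  private strings.
\<close>
type_synonym ('x, 'y) outcome = "('x \<times> 'y) \<times> tape \<times> tape \<times> tape"

definition execution :: "('x, 'y) protocol \<Rightarrow> ('x \<times> 'y) pmf \<Rightarrow> ('x, 'y) outcome measure" where
  "execution \<pi> D = measure_pmf D \<Otimes>\<^sub>M public_law \<pi> \<Otimes>\<^sub>M alice_law \<pi> \<Otimes>\<^sub>M bob_law \<pi>"

definition alice_input :: "('x, 'y) outcome \<Rightarrow> 'x" where
  "alice_input \<omega> = fst (fst \<omega>)"

definition bob_input :: "('x, 'y) outcome \<Rightarrow> 'y" where
  "bob_input \<omega> = snd (fst \<omega>)"

text \<open>The transcript comprises the public random string.\<close>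
definition transcript :: "('x, 'y) protocol \<Rightarrow> ('x, 'y) outcome \<Rightarrow> tape \<times> bool list" where
  "transcript \<pi> = (\<lambda>((x, y), r, ra, rb). (r, messages (tree \<pi> r) x y ra rb))"

definition transcript_space :: "('x, 'y) protocol \<Rightarrow> (tape \<times> bool list) measure" where
  "transcript_space \<pi> = public_law \<pi> \<Otimes>\<^sub>M count_space UNIV"

section \<open>Internal information cost\<close>

text \<open>
  Information is measured in bits. The inputs are restricted to countable types because they carry
  the discrete sigma-algebra.
\<close>
definition internal_ic ::
    "('x::countable, 'y::countable) protocol \<Rightarrow> ('x \<times> 'y) pmf \<Rightarrow> real" where
  "internal_ic \<pi> D =
    prob_space.conditional_mutual_information (execution \<pi> D) 2
      (transcript_space \<pi>) (count_space UNIV) (count_space UNIV)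
      (transcript \<pi>) alice_input bob_input +
    prob_space.conditional_mutual_information (execution \<pi> D) 2
      (transcript_space \<pi>) (count_space UNIV) (count_space UNIV)
      (transcript \<pi>) bob_input alice_input"

section \<open>Set intersection\<close>

text \<open>
  Elements are numbered \<open>0, \<dots>, n - 1\<close>, and sets are given by characteristic vectors, here lists
  of length \<open>n\<close>.
\<close>
definition D_SI :: "nat \<Rightarrow> (bool list \<times> bool list) pmf" where
  "D_SI n = do {
     xs \<leftarrow> replicate_pmf n (pmf_of_set {(False, False), (False, True), (True, False)});
     t \<leftarrow> pmf_of_set {..<n};
     let ys = xs[t := (True, True)];
     return_pmf (map fst ys, map snd ys)
   }"

definition target :: "bool list \<Rightarrow> bool list \<Rightarrow> nat" where
  "target A B = (THE t. t < length A \<and> A ! t \<and> B ! t)"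

text \<open>Total variation distance of two probability mass functions on a finite set.\<close>
definition tvd :: "'a set \<Rightarrow> ('a \<Rightarrow> real) \<Rightarrow> ('a \<Rightarrow> real) \<Rightarrow> real" where
  "tvd X p q = (\<Sum>x\<in>X. \<bar>p x - q x\<bar>) / 2"

text \<open>
  The probability mass function of the target conditioned on the transcript, at the outcome
  \<open>\<omega>\<close>. As the public randomness may be continuous, this is a conditional expectation with respect
  to the sigma-algebra generated by the transcript (determined almost surely).
\<close>
definition target_dist ::
    "(bool list, bool list) protocol \<Rightarrow> nat \<Rightarrow> (bool list, bool list) outcome \<Rightarrow> nat \<Rightarrow> real" where
  "target_dist \<pi> n \<omega> t =
    real_cond_exp (execution \<pi> (D_SI n))
      (vimage_algebra (space (execution \<pi> (D_SI n))) (transcript \<pi>) (transcript_space \<pi>))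
      (indicator {\<omega>'. target (alice_input \<omega>') (bob_input \<omega>') = t}) \<omega>"

definition solves_set_int :: "(bool list, bool list) protocol \<Rightarrow> nat \<Rightarrow> real \<Rightarrow> bool" where
  "solves_set_int \<pi> n \<epsilon> \<longleftrightarrow>
    (\<integral>\<omega>. tvd {..<n} (target_dist \<pi> n \<omega>) (pmf (pmf_of_set {..<n})) \<partial>execution \<pi> (D_SI n)) \<ge> \<epsilon>"

end

theory Submission
  imports Defs
begin

text \<open>
  At a fixed transcript the probabilities \<open>f a b\<close> of that transcript on the inputs \<open>a, b\<close> form a rank-one
  matrix. \<open>D_SI\<close> is uniform on the pairs of sets that meet in exactly one element, so by convexity
  its information cost is at least the average over the target \<open>t\<close> of the cost of the remaining
  coordinates, which are independent uniform disjoint pairs. There Alice's information is expanded by the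
  chain rule from the front and Bob's from the back, so that every coordinate is examined in a context in
  which the rest of the two inputs is independent; cut-and-paste then bounds the squared Hellinger
  distance between the transcript with target \<open>t\<close> and the transcript with intersection \<open>{s, t}\<close>. By
  symmetry in \<open>s\<close> and \<open>t\<close> and the triangle inequality, the laws of the transcript for all targets are
  close to each other, hence so is the posterior of the target to the uniform distribution.

  All inequalities are proved pointwise at a transcript, up to a linear functional of the matrix \<open>f\<close> that
  integrates to zero; only this last form is integrated over the public randomness.
\<close>

section \<open>Entropy, Jensen-Shannon divergence and Hellinger distance\<close>

text \<open>Cut-and-paste compares four values of one pair of bits, among them (1,1), which the
  disjoint law never produces, so both players' information about that pair must be measured in one
  common context. At coordinate i it consists of Alice's bits before i and Bob's bits after i.
  Averaged out are then Alice's later and Bob's earlier bits, which are independent given the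
  context, so rank one survives. Expanding both inputs from the same end would average over
  correlated pairs and destroy it. The price is that each player's information is measured with
  fewer known bits than the chain rule allows, which can only lower it.

  Constants: cut-and-paste and \<open>js_ge_hell\<close> give 1/16; a player's bit is undetermined
  by the other one with probability 2/3, which gives 1/24; passing through the intersection {s, t}
  costs a factor 4, which gives 1/96.

  Public strings may be continuous and messages arbitrarily long, so the entropy of a transcript may
  be infinite. Pointwise inequalities avoid it: only differences of entropies are ever
  integrated.\<close>

definition xlnx :: "real \<Rightarrow> real" where
  "xlnx x = x * ln x"

definition hell :: "real \<Rightarrow> real \<Rightarrow> real" where
  "hell x y = (sqrt x - sqrt y)\<^sup>2"

text \<open>Contribution of one transcript, in nats, to the information about a uniform bit whose
  two values give that transcript the probabilities \<open>x\<close> and \<open>y\<close>.\<close>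

definition js :: "real \<Rightarrow> real \<Rightarrow> real" where
  "js x y = (xlnx x + xlnx y) / 2 - xlnx ((x + y) / 2)"

lemma xlnx_0 [simp]: "xlnx 0 = 0"
  by (simp add: xlnx_def)

text \<open>The left side is the tangent of \<open>a * ln (a / c)\<close> at
  \<open>a = c * r\<close>. The logarithmic convexity bounds below come from this tangent with a
  suitable slope.\<close>

lemma mult_ln_ratio_ge:
  fixes a c r :: real
  assumes "0 \<le> a" "0 \<le> c" "c = 0 \<Longrightarrow> a = 0" "0 < r"
  shows "a * ln r + a - c * r \<le> a * ln (a / c)"
proof (cases "a = 0")
  case False
  then have pos: "0 < a" "0 < c" using assms by force+
  have "ln (c * r / a) \<le> c * r / a - 1"
    by (rule ln_le_minus_one) (use pos assms in auto)
  moreover have "ln (c * r / a) = ln r - ln (a / c)"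
    using pos assms by (simp add: ln_div ln_mult)
  ultimately have "a * (ln r - ln (a / c)) \<le> a * (c * r / a - 1)"
    using pos by (intro mult_left_mono) auto
  then show ?thesis using pos by (simp add: algebra_simps)
qed (use assms in auto)

lemma xlnx_ge_tangent:
  assumes "0 \<le> y" "0 < m"
  shows "y * ln m + y - m \<le> xlnx y"
  using mult_ln_ratio_ge[of y 1 m] assms by (simp add: xlnx_def)

lemma log_sum_two:
  fixes a b c d :: real
  assumes nn: "0 \<le> a" "0 \<le> b" "0 \<le> c" "0 \<le> d"
    and ac: "c = 0 \<Longrightarrow> a = 0" "d = 0 \<Longrightarrow> b = 0"
  shows "(a + b) * ln ((a + b) / (c + d)) \<le> a * ln (a / c) + b * ln (b / d)"
proof (cases "a + b = 0")
  case True
  then have "a = 0" "b = 0" using nn by auto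
  then show ?thesis by simp
next
  case False
  then have pos: "0 < a + b" "0 < c + d" using nn ac by force+
  \<comment> \<open>One slope for both tangents: with the pooled ratio the two linear remainders
    cancel.\<close>
  define r where "r = (a + b) / (c + d)"
  have r: "0 < r" "(c + d) * r = a + b" using pos by (auto simp: r_def)
  have "a * ln r + a - c * r \<le> a * ln (a / c)" "b * ln r + b - d * r \<le> b * ln (b / d)"
    by (intro mult_ln_ratio_ge; use nn ac r in auto)+
  moreover have "(a + b) * ln r = (a * ln r + a - c * r) + (b * ln r + b - d * r)"
    using r(2) by (simp add: algebra_simps)
  ultimately show ?thesis unfolding r_def[symmetric] by linarith
qed

lemma sum_xlnx_jensen:
  fixes w g :: "'i \<Rightarrow> real"
  assumes "finite I" "\<And>i. i \<in> I \<Longrightarrow> 0 \<le> w i" "\<And>i. i \<in> I \<Longrightarrow> 0 \<le> g i"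
  shows "sum w I * xlnx ((\<Sum>i\<in>I. w i * g i) / sum w I) \<le> (\<Sum>i\<in>I. w i * xlnx (g i))"
proof -
  define W where "W = sum w I"
  define m where "m = (\<Sum>i\<in>I. w i * g i) / W"
  have W0: "0 \<le> W" unfolding W_def by (rule sum_nonneg) (use assms in auto)
  have q0: "0 \<le> (\<Sum>i\<in>I. w i * g i)" by (rule sum_nonneg) (use assms in auto)
  show ?thesis
  proof (cases "m = 0")
    case True
    \<comment> \<open>\<open>xlnx\<close> has no tangent at 0. The case also covers total weight 0,
      where the quotient is 0 by convention; either way every product \<open>w i * g i\<close>
      vanishes.\<close>
    have wg: "\<forall>i\<in>I. w i * g i = 0"
    proof (cases "W = 0")
      case True
      then have "\<forall>i\<in>I. w i = 0"
        using assms unfolding W_def by (subst (asm) sum_nonneg_eq_0_iff) auto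
      then show ?thesis by auto
    next
      case False
      with \<open>m = 0\<close> have "(\<Sum>i\<in>I. w i * g i) = 0" by (auto simp: m_def)
      then show ?thesis using assms by (subst (asm) sum_nonneg_eq_0_iff) auto
    qed
    have "(\<Sum>i\<in>I. w i * xlnx (g i)) = (\<Sum>i\<in>I. (w i * g i) * ln (g i))"
      by (simp add: xlnx_def mult.assoc)
    also have "\<dots> = 0" using wg by (intro sum.neutral) auto
    finally show ?thesis using True unfolding m_def W_def by (metis mult_zero_right order_refl xlnx_0)
  next
    case False
    then have "0 < m" "0 < W" using W0 q0 by (auto simp: m_def divide_nonneg_nonneg less_le)
    have "W * xlnx m = (\<Sum>i\<in>I. w i * (g i * ln m + g i - m))"
    proof -
      have mW: "(\<Sum>i\<in>I. w i * g i) = m * W" using \<open>0 < W\<close> by (simp add: m_def)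
      have "(\<Sum>i\<in>I. w i * (g i * ln m + g i - m)) =
          (\<Sum>i\<in>I. w i * g i) * ln m + (\<Sum>i\<in>I. w i * g i) - W * m"
        by (simp add: W_def algebra_simps sum.distrib sum_subtractf sum_distrib_left sum_distrib_right)
      then show ?thesis unfolding mW by (simp add: xlnx_def)
    qed
    also have "\<dots> \<le> (\<Sum>i\<in>I. w i * xlnx (g i))"
      by (intro sum_mono mult_left_mono xlnx_ge_tangent) (use assms \<open>0 < m\<close> in auto)
    finally show ?thesis by (simp add: m_def W_def)
  qed
qed

section \<open>Pointwise inequalities for the squared Hellinger distance\<close>

lemma hell_nonneg [simp]: "0 \<le> hell x y"
  by (simp add: hell_def)

lemma hell_commute: "hell x y = hell y x"
  by (simp add: hell_def power2_commute)

lemma hell_expand: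
  assumes "0 \<le> x" "0 \<le> y"
  shows "hell x y = x + y - 2 * sqrt (x * y)"
  using assms by (simp add: hell_def power2_diff real_sqrt_mult)

lemma hell_triangle: "hell x z \<le> 2 * hell x y + 2 * hell y z"
proof -
  have "(a - c)\<^sup>2 \<le> 2 * (a - b)\<^sup>2 + 2 * (b - c)\<^sup>2" for a b c :: real
    using zero_le_power2[of "(a - b) - (b - c)"] by (simp add: power2_eq_square algebra_simps)
  then show ?thesis unfolding hell_def .
qed

lemma hell_same [simp]: "hell x x = 0"
  by (simp add: hell_def)

lemma hell_scale:
  assumes "0 \<le> c"
  shows "hell (c * x) (c * y) = c * hell x y"
  using assms by (simp add: hell_def real_sqrt_mult power_mult_distrib flip: right_diff_distrib)

text \<open>Cauchy-Schwarz for the vectors of square roots. Together with \<open>hell_scale\<close>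
  this makes \<open>hell\<close> jointly convex.\<close>

lemma hell_add:
  assumes "0 \<le> x" "0 \<le> y" "0 \<le> x'" "0 \<le> y'"
  shows "hell (x + x') (y + y') \<le> hell x y + hell x' y'"
proof -
  have "(sqrt (x * y) + sqrt (x' * y'))\<^sup>2 \<le> (x + x') * (y + y')"
  proof -
    have "0 \<le> (sqrt (x * y') - sqrt (x' * y))\<^sup>2" by simp
    then have "2 * (sqrt (x * y') * sqrt (x' * y)) \<le> x * y' + x' * y"
      using assms by (simp add: power2_diff)
    moreover have "sqrt (x * y') * sqrt (x' * y) = sqrt (x * y) * sqrt (x' * y')"
      by (simp add: real_sqrt_mult)
    ultimately show ?thesis using assms by (simp add: power2_sum algebra_simps)
  qed
  then have "sqrt (x * y) + sqrt (x' * y') \<le> sqrt ((x + x') * (y + y'))"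
    by (rule real_le_rsqrt)
  then show ?thesis using assms by (simp add: hell_expand)
qed

text \<open>Factor the difference through the square roots and apply AM-GM. The free parameter
  \<open>k\<close> lets this replace Cauchy-Schwarz on integrals by a pointwise bound.\<close>

lemma abs_diff_le_hell:
  assumes "0 \<le> x" "0 \<le> y" "0 < k"
  shows "\<bar>x - y\<bar> \<le> hell x y / (2 * k) + k * (x + y)"
proof -
  define u v where "u = sqrt x" and "v = sqrt y"
  have uv: "0 \<le> u" "0 \<le> v" "x = u\<^sup>2" "y = v\<^sup>2" using assms by (auto simp: u_def v_def)
  have "x - y = (u - v) * (u + v)" unfolding uv by (simp add: power2_eq_square algebra_simps)
  then have e: "\<bar>x - y\<bar> = \<bar>u - v\<bar> * (u + v)" using uv by (simp add: abs_mult)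
  have "0 \<le> (\<bar>u - v\<bar> - k * (u + v))\<^sup>2" by simp
  then have "2 * k * \<bar>x - y\<bar> \<le> (u - v)\<^sup>2 + k\<^sup>2 * (u + v)\<^sup>2"
    unfolding e by (simp add: power2_diff power_mult_distrib mult_ac)
  also have "(u + v)\<^sup>2 \<le> 2 * (x + y)"
  proof -
    have "0 \<le> (u - v)\<^sup>2" by simp
    then show ?thesis unfolding uv by (simp add: power2_eq_square algebra_simps)
  qed
  then have "(u - v)\<^sup>2 + k\<^sup>2 * (u + v)\<^sup>2 \<le> (u - v)\<^sup>2 + k\<^sup>2 * (2 * (x + y))"
    by (intro add_left_mono mult_left_mono) auto
  finally have "2 * k * \<bar>x - y\<bar> \<le> hell x y + k\<^sup>2 * (2 * (x + y))"
    by (simp add: hell_def u_def v_def)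
  then show ?thesis using assms by (simp add: field_simps power2_eq_square)
qed

section \<open>Jensen-Shannon divergence against Hellinger distance\<close>

lemma js_eq:
  assumes "0 \<le> x" "0 \<le> y"
  shows "js x y = (x * ln (x / ((x + y) / 2)) + y * ln (y / ((x + y) / 2))) / 2"
proof -
  define m where "m = (x + y) / 2"
  have "z * ln (z / m) = z * ln z - z * ln m" if "z = x \<or> z = y" for z
  proof (cases "z = 0")
    case False
    then have "0 < z" "0 < m" using that assms by (auto simp: m_def)
    then show ?thesis by (simp add: ln_div right_diff_distrib)
  qed simp
  from this[of x] this[of y] have "x * ln (x / m) = x * ln x - x * ln m"
    "y * ln (y / m) = y * ln y - y * ln m" by auto
  moreover have "m * ln m = (x * ln m + y * ln m) / 2"
    unfolding m_def by (simp add: field_simps)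
  ultimately show ?thesis
    unfolding js_def xlnx_def m_def[symmetric] by argo
qed

text \<open>Joint convexity at a midpoint: \<open>js_eq\<close> writes \<open>js\<close> as two
  terms of the form \<open>a * ln (a / c)\<close>, and each obeys the log-sum inequality.\<close>

lemma js_half:
  assumes "0 \<le> x" "0 \<le> y" "0 \<le> x'" "0 \<le> y'"
  shows "js ((x + x') / 2) ((y + y') / 2) \<le> (js x y + js x' y') / 2"
proof -
  have hom: "(a / 2 + b / 2) * ln ((a / 2 + b / 2) / (c / 2 + d / 2)) \<le>
      a / 2 * ln (a / c) + b / 2 * ln (b / d)"
    if "0 \<le> a" "0 \<le> b" "0 \<le> c" "0 \<le> d" "c = 0 \<Longrightarrow> a = 0" "d = 0 \<Longrightarrow> b = 0" for a b c d :: real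
    using log_sum_two[of "a/2" "b/2" "c/2" "d/2"] that by simp
  have "(x / 2 + x' / 2) * ln ((x / 2 + x' / 2) / (((x + y)/2) / 2 + ((x' + y')/2) / 2)) \<le>
      x / 2 * ln (x / ((x + y) / 2)) + x' / 2 * ln (x' / ((x' + y') / 2))"
    by (rule hom) (use assms in auto)
  moreover have "(y / 2 + y' / 2) * ln ((y / 2 + y' / 2) / (((x + y)/2) / 2 + ((x' + y')/2) / 2)) \<le>
      y / 2 * ln (y / ((x + y) / 2)) + y' / 2 * ln (y' / ((x' + y') / 2))"
    by (rule hom) (use assms in auto)
  ultimately show ?thesis
    using assms by (simp add: js_eq add_divide_distrib algebra_simps)
qed

text \<open>Each logarithm is bounded by \<open>ln_le_minus_one\<close> at a square root of the
  ratio; this turns \<open>js\<close> into an expression in square roots, with the midpoint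
  \<open>m\<close> still under a root.\<close>

lemma js_ge_hell:
  assumes "0 \<le> x" "0 \<le> y"
  shows "hell x y / 4 \<le> js x y"
proof (cases "x + y = 0")
  case True
  then have "x = 0" "y = 0" using assms by auto
  then show ?thesis by (simp add: js_def)
next
  case False
  define m where "m = (x + y) / 2"
  have m: "0 < m" using False assms by (simp add: m_def)
  have ln_bound: "2 * z - 2 * sqrt z * sqrt m \<le> z * ln (z / m)" if "0 \<le> z" for z
  proof (cases "z = 0")
    case False
    then have z: "0 < z" using that by simp
    have "ln (sqrt (m / z)) \<le> sqrt (m / z) - 1"
      by (rule ln_le_minus_one) (use z m in auto)
    moreover have "ln (z / m) = - 2 * ln (sqrt (m / z))"
      using z m by (simp add: ln_sqrt ln_div)
    ultimately have "2 - 2 * sqrt (m / z) \<le> ln (z / m)" by simp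
    then have "z * (2 - 2 * sqrt (m / z)) \<le> z * ln (z / m)" using z by simp
    moreover have "z * sqrt (m / z) = sqrt z * sqrt m"
      using z by (simp add: real_sqrt_divide real_div_sqrt mult.commute flip: times_divide_eq_left)
    ultimately show ?thesis by (simp add: algebra_simps)
  qed simp
  \<comment> \<open>AM-GM removes the root of \<open>m\<close>; since \<open>m\<close> is half of
    \<open>x + y\<close>, exactly a quarter of \<open>hell x y\<close> remains.\<close>
  have "a * (b + c) \<le> a\<^sup>2 + (b\<^sup>2 + c\<^sup>2 + 2 * (b * c)) / 4" for a b c :: real
    using zero_le_power2[of "2 * a - b - c"] by (simp add: power2_eq_square field_simps)
  from this[of "sqrt m" "sqrt x" "sqrt y"]
  have "sqrt m * (sqrt x + sqrt y) \<le> m + (x + y + 2 * (sqrt x * sqrt y)) / 4"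
    using m assms by simp
  moreover have "hell x y = x + y - 2 * (sqrt x * sqrt y)"
    using assms by (simp add: hell_expand real_sqrt_mult)
  moreover have "x + y - sqrt m * (sqrt x + sqrt y) \<le> js x y"
    using ln_bound[of x] ln_bound[of y] assms by (simp add: js_eq algebra_simps flip: m_def)
  moreover have "hell x y / 4 \<le> j" if "p \<le> m + (x + y + 2 * r) / 4" "hell x y = x + y - 2 * r"
      "x + y - p \<le> j" for p r j :: real
    using that by (simp add: m_def field_simps)
  ultimately show ?thesis by blast
qed

text \<open>The defect \<open>g00 + g11 - g01 - g10\<close> is what the cut-and-paste identity leaves at a single
  transcript; summed over all transcripts it vanishes, since the four laws have the same mass.\<close>
lemma cut_paste_bound:
  assumes nn: "0 \<le> g00" "0 \<le> g01" "0 \<le> g10" "0 \<le> g11"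
    and rect: "g00 * g11 = g01 * g10"
  shows "((hell g00 g11 + hell g01 g11 + hell g10 g11) / 3
      - 5 / 3 * (g00 + g11 - g01 - g10)) / 16 \<le> js g00 g10 + js g00 g01"
proof -
  \<comment> \<open>By \<open>rect\<close> the geometric means of both pairs agree, so only the
    linear parts differ, and they differ by the defect.\<close>
  have "hell g00 g11 = hell g10 g01 + (g00 + g11 - g01 - g10)"
    using nn rect by (simp add: hell_expand mult.commute)
  moreover have "hell g10 g01 \<le> 2 * hell g00 g10 + 2 * hell g00 g01"
    using hell_triangle[of g10 g01 g00] by (simp add: hell_commute)
  moreover have "hell g01 g11 \<le> 2 * hell g00 g01 + 2 * hell g00 g11"
    using hell_triangle[of g01 g11 g00] by (simp add: hell_commute)
  moreover have "hell g10 g11 \<le> 2 * hell g00 g10 + 2 * hell g00 g11"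
    using hell_triangle[of g10 g11 g00] by (simp add: hell_commute)
  moreover have "hell g00 g10 / 4 \<le> js g00 g10" "hell g00 g01 / 4 \<le> js g00 g01"
    by (intro js_ge_hell nn)+
  \<comment> \<open>Let u and v be the distances from \<open>g00\<close> to \<open>g10\<close> and
    to \<open>g01\<close>, and d the defect. The distances to \<open>g11\<close> from
    \<open>g00\<close>, \<open>g01\<close>, \<open>g10\<close> are at most 2u + 2v + d, 4u + 6v + 2d
    and 6u + 4v + 2d, with mean 4(u + v) + 5d/3; and u + v is at most 4 times the right-hand
    side.\<close>
  ultimately show ?thesis by argo
qed

section \<open>Information about disjoint pairs\<close>

text \<open>\<open>avg_marg n\<close>, \<open>avg_cond b\<close> and \<open>avg_disj n\<close> are expectations when the pairs \<open>(a ! i, b ! i)\<close> are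
  independent and uniform on \<open>(0,0), (0,1), (1,0)\<close>: over \<open>b\<close>, over \<open>a\<close> given \<open>b\<close>, and over both.\<close>
primrec avg_marg :: "nat \<Rightarrow> (bool list \<Rightarrow> real) \<Rightarrow> real" where
  "avg_marg 0 h = h []"
| "avg_marg (Suc n) h =
    2 / 3 * avg_marg n (\<lambda>b. h (False # b)) + 1 / 3 * avg_marg n (\<lambda>b. h (True # b))"

primrec avg_cond :: "bool list \<Rightarrow> (bool list \<Rightarrow> real) \<Rightarrow> real" where
  "avg_cond [] h = h []"
| "avg_cond (c # b) h =
    (if c then avg_cond b (\<lambda>a. h (False # a))
     else (avg_cond b (\<lambda>a. h (False # a)) + avg_cond b (\<lambda>a. h (True # a))) / 2)"

definition avg_disj :: "nat \<Rightarrow> (bool list \<Rightarrow> bool list \<Rightarrow> real) \<Rightarrow> real" where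
  "avg_disj n f = avg_marg n (\<lambda>b. avg_cond b (\<lambda>a. f a b))"

section \<open>Linearity, convexity and symmetry of the averages\<close>

lemma avg_marg_add: "avg_marg n (\<lambda>b. h b + k b) = avg_marg n h + avg_marg n k"
  by (induction n arbitrary: h k) (simp_all add: algebra_simps)

lemma avg_marg_cmult: "avg_marg n (\<lambda>b. c * h b) = c * avg_marg n h"
  by (induction n arbitrary: h) (simp_all add: algebra_simps)

lemma avg_marg_const: "avg_marg n (\<lambda>b. c) = c"
  by (induction n) simp_all

lemma avg_marg_divide: "avg_marg n (\<lambda>b. h b / c) = avg_marg n h / c"
  using avg_marg_cmult[of n "inverse c" h] by (simp add: field_simps)

lemma avg_marg_diff: "avg_marg n (\<lambda>b. h b - k b) = avg_marg n h - avg_marg n k"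
  using avg_marg_add[of n h "\<lambda>b. (-1) * k b"] avg_marg_cmult[of n "-1" k] by simp

lemma avg_marg_mono:
  "(\<And>b. length b = n \<Longrightarrow> h b \<le> k b) \<Longrightarrow> avg_marg n h \<le> avg_marg n k"
proof (induction n arbitrary: h k)
  case (Suc n)
  have "avg_marg n (\<lambda>b. h (c # b)) \<le> avg_marg n (\<lambda>b. k (c # b))" for c
    by (rule Suc.IH) (simp add: Suc.prems)
  from this[of False] this[of True] show ?case by simp
qed simp

lemma avg_marg_nonneg: "(\<And>b. 0 \<le> h b) \<Longrightarrow> 0 \<le> avg_marg n h"
  by (induction n arbitrary: h) simp_all

lemma avg_cond_add: "avg_cond b (\<lambda>a. h a + k a) = avg_cond b h + avg_cond b k"
  by (induction b arbitrary: h k) (simp_all add: field_simps)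

lemma avg_cond_cmult: "avg_cond b (\<lambda>a. c * h a) = c * avg_cond b h"
  by (induction b arbitrary: h) (simp_all add: field_simps)

lemma avg_cond_const: "avg_cond b (\<lambda>a. c) = c"
  by (induction b) simp_all

lemma avg_cond_divide: "avg_cond b (\<lambda>a. h a / c) = avg_cond b h / c"
  using avg_cond_cmult[of b "inverse c" h] by (simp add: field_simps)

lemma avg_cond_diff: "avg_cond b (\<lambda>a. h a - k a) = avg_cond b h - avg_cond b k"
  using avg_cond_add[of b h "\<lambda>b. (-1) * k b"] avg_cond_cmult[of b "-1" k] by simp

lemma avg_cond_nonneg: "(\<And>a. 0 \<le> h a) \<Longrightarrow> 0 \<le> avg_cond b h"
  by (induction b arbitrary: h) simp_all

text \<open>Data processing: a bit is less visible in the transcript once the remaining bits are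
  averaged out.\<close>

lemma avg_cond_js:
  assumes "\<And>a. 0 \<le> h a" "\<And>a. 0 \<le> k a"
  shows "js (avg_cond b h) (avg_cond b k) \<le> avg_cond b (\<lambda>a. js (h a) (k a))"
  using assms
proof (induction b arbitrary: h k)
  case (Cons c b)
  have IH: "js (avg_cond b (\<lambda>a. h (d # a))) (avg_cond b (\<lambda>a. k (d # a)))
      \<le> avg_cond b (\<lambda>a. js (h (d # a)) (k (d # a)))" for d
    by (rule Cons.IH) (use Cons.prems in auto)
  show ?case
  proof (cases c)
    case True
    then show ?thesis using IH by simp
  next
    case False
    have nn: "0 \<le> avg_cond b (\<lambda>a. h (d # a))" "0 \<le> avg_cond b (\<lambda>a. k (d # a))" for d
      by (simp_all add: Cons.prems avg_cond_nonneg)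
    from js_half[OF nn[of False] nn[of True]] IH[of False] IH[of True] False
    show ?thesis by simp
  qed
qed simp

text \<open>A product of two averages is a double average over independent copies, so a rank-one
  identity that holds for every pair \<open>a\<close>, \<open>a'\<close> passes to the
  averages.\<close>

lemma avg_cond_mult_cong:
  assumes "\<And>a a'. h a * k a' = h' a * k' a'"
  shows "avg_cond b h * avg_cond b k = avg_cond b h' * avg_cond b k'"
proof -
  have eq: "avg_cond b u * avg_cond b v = avg_cond b (\<lambda>a. avg_cond b (\<lambda>a'. u a * v a'))" for u v
    unfolding avg_cond_cmult using avg_cond_cmult[of b "avg_cond b v" u] by (simp add: mult.commute)
  show ?thesis by (simp add: eq assms)
qed

lemma avg_marg_hell:
  assumes "\<And>b. 0 \<le> h b" "\<And>b. 0 \<le> k b"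
  shows "hell (avg_marg n h) (avg_marg n k) \<le> avg_marg n (\<lambda>b. hell (h b) (k b))"
  using assms
proof (induction n arbitrary: h k)
  case (Suc n)
  let ?h = "\<lambda>c. avg_marg n (\<lambda>b. h (c # b))" and ?k = "\<lambda>c. avg_marg n (\<lambda>b. k (c # b))"
  have IH: "hell (?h c) (?k c) \<le> avg_marg n (\<lambda>b. hell (h (c # b)) (k (c # b)))" for c
    by (rule Suc.IH) (use Suc.prems in auto)
  have nn: "0 \<le> ?h c" "0 \<le> ?k c" for c
    by (simp_all add: Suc.prems avg_marg_nonneg)
  have "hell (2/3 * ?h False + 1/3 * ?h True) (2/3 * ?k False + 1/3 * ?k True)
      \<le> hell (2/3 * ?h False) (2/3 * ?k False) + hell (1/3 * ?h True) (1/3 * ?k True)"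
    by (rule hell_add) (use nn[of True] nn[of False] in auto)
  also have "\<dots> = 2/3 * hell (?h False) (?k False) + 1/3 * hell (?h True) (?k True)"
    by (subst (1 2) hell_scale) auto
  finally show ?case using IH[of True] IH[of False] by simp
qed simp

lemma avg_disj_0: "avg_disj 0 f = f [] []"
  by (simp add: avg_disj_def)

lemma avg_disj_Suc:
  "avg_disj (Suc n) f = (avg_disj n (\<lambda>a b. f (False # a) (False # b))
    + avg_disj n (\<lambda>a b. f (False # a) (True # b))
    + avg_disj n (\<lambda>a b. f (True # a) (False # b))) / 3"
  by (simp add: avg_disj_def avg_marg_add avg_marg_divide)

lemma avg_disj_add: "avg_disj n (\<lambda>a b. f a b + g a b) = avg_disj n f + avg_disj n g"
  by (simp add: avg_disj_def avg_marg_add avg_cond_add)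

lemma avg_disj_diff: "avg_disj n (\<lambda>a b. f a b - g a b) = avg_disj n f - avg_disj n g"
  by (simp add: avg_disj_def avg_marg_diff avg_cond_diff)

lemma avg_disj_divide: "avg_disj n (\<lambda>a b. f a b / c) = avg_disj n f / c"
  by (simp add: avg_disj_def avg_marg_divide avg_cond_divide)

lemma avg_disj_const: "avg_disj n (\<lambda>a b. c) = c"
  by (simp add: avg_disj_def avg_marg_const avg_cond_const)

lemma avg_disj_nonneg: "(\<And>a b. 0 \<le> f a b) \<Longrightarrow> 0 \<le> avg_disj n f"
  by (simp add: avg_disj_def avg_marg_nonneg avg_cond_nonneg)

text \<open>The base law is symmetric in the players, although \<open>avg_disj\<close> draws Bob's
  vector first.\<close>

lemma avg_disj_swap: "avg_disj n (\<lambda>a b. f b a) = avg_disj n f"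
proof (induction n arbitrary: f)
  case (Suc n)
  show ?case using Suc[of "\<lambda>a b. f (c # a) (d # b)" for c d] by (simp add: avg_disj_Suc)
qed (simp add: avg_disj_0)

section \<open>Information split coordinate by coordinate\<close>

definition ent_marg :: "nat \<Rightarrow> (bool list \<Rightarrow> bool list \<Rightarrow> real) \<Rightarrow> real" where
  "ent_marg n f = avg_marg n (\<lambda>b. xlnx (avg_cond b (\<lambda>a. f a b)))"

text \<open>The contribution of one transcript to \<open>I(\<Pi>; A | B) + I(\<Pi>; B | A)\<close> when \<open>f a b\<close> is the probability
  of that transcript on the inputs \<open>a, b\<close>.\<close>
definition disj_info :: "nat \<Rightarrow> (bool list \<Rightarrow> bool list \<Rightarrow> real) \<Rightarrow> real" where
  "disj_info n f =
    2 * avg_disj n (\<lambda>a b. xlnx (f a b)) - ent_marg n f - ent_marg n (\<lambda>a b. f b a)"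

definition slice :: "bool \<Rightarrow> bool \<Rightarrow> (bool list \<Rightarrow> bool list \<Rightarrow> real) \<Rightarrow> bool list \<Rightarrow> bool list \<Rightarrow> real" where
  "slice c d f a b = f (c # a) (d # b)"

text \<open>Alice's first bit is 0 and Bob's first bit is averaged given this. The matrix keeps rank one,
  which is what makes the induction on the number of coordinates work.\<close>
definition slice_mix :: "(bool list \<Rightarrow> bool list \<Rightarrow> real) \<Rightarrow> bool list \<Rightarrow> bool list \<Rightarrow> real" where
  "slice_mix f a b = (slice False False f a b + slice False True f a b) / 2"

text \<open>For a discrete transcript \<open>ent_marg n f\<close> sums to minus its entropy given
  Bob's input. Alice's first bit is split off first, given all of Bob's vector; Bob's first bit
  comes last, given Alice's vector and his own tail. Left over is the information about the tails:
  Alice's first bit is then known, and where it is 0 Bob's is averaged out, hence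
  \<open>slice_mix\<close>. Either first bit is undetermined by the other with probability 2/3, the
  weight of the \<open>js\<close> terms.\<close>

lemma disj_info_Suc:
  fixes f :: "bool list \<Rightarrow> bool list \<Rightarrow> real"
  defines "g \<equiv> \<lambda>c d b. avg_cond b (\<lambda>a. slice c d f a b)"
  assumes f: "\<And>a b. 0 \<le> f a b"
  shows "2 / 3 * disj_info n (slice_mix f) + 1 / 3 * disj_info n (slice True False f)
    + 2 / 3 * avg_marg n (\<lambda>b. js (g False False b) (g True False b) + js (g False False b) (g False True b))
    \<le> disj_info (Suc n) f"
proof -
  define m where "m = (\<lambda>c d. avg_marg n (\<lambda>b. xlnx (g c d b)))"
  define e where "e = (\<lambda>c d. avg_disj n (\<lambda>a b. xlnx (slice c d f a b)))"
  define x where "x = avg_disj n (\<lambda>a b. xlnx (slice_mix f a b))"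
  define s where "s = avg_marg n (\<lambda>b. xlnx ((g False False b + g True False b) / 2))"
  define mF where "mF = avg_marg n (\<lambda>b. xlnx ((g False False b + g False True b) / 2))"
  have B: "ent_marg (Suc n) f = 2/3 * s + 1/3 * m False True"
    by (simp add: ent_marg_def g_def slice_def s_def m_def)
  have mix: "avg_cond b (\<lambda>a. slice_mix f a b) = (g False False b + g False True b) / 2" for b
    by (simp add: slice_mix_def g_def avg_cond_add avg_cond_divide)
  have "ent_marg (Suc n) (\<lambda>a b. f b a) =
      2/3 * ent_marg n (\<lambda>a b. slice_mix f b a) + 1/3 * ent_marg n (\<lambda>a b. slice True False f b a)"
    by (simp add: ent_marg_def slice_mix_def slice_def avg_cond_add avg_cond_divide add_divide_distrib)
  moreover have "avg_disj (Suc n) (\<lambda>a b. xlnx (f a b)) = (e False False + e False True + e True False) / 3"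
    by (simp add: avg_disj_Suc e_def slice_def)
  ultimately have full: "disj_info (Suc n) f = 2/3 * (e False False + e False True + e True False)
      - (2/3 * s + 1/3 * m False True)
      - (2/3 * ent_marg n (\<lambda>a b. slice_mix f b a) + 1/3 * ent_marg n (\<lambda>a b. slice True False f b a))"
    by (simp add: disj_info_def B)
  have i1: "disj_info n (slice_mix f) = 2 * x - mF - ent_marg n (\<lambda>a b. slice_mix f b a)"
    by (simp add: disj_info_def x_def mF_def ent_marg_def mix)
  have i2: "disj_info n (slice True False f) = 2 * e True False - m True False - ent_marg n (\<lambda>a b. slice True False f b a)"
    by (simp add: disj_info_def e_def m_def ent_marg_def g_def)
  have j1: "avg_marg n (\<lambda>b. js (g False False b) (g True False b)) = (m False False + m True False) / 2 - s"
    by (simp add: js_def avg_marg_diff avg_marg_divide avg_marg_add m_def s_def)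
  have j2: "avg_marg n (\<lambda>b. js (g False False b) (g False True b)) = (m False False + m False True) / 2 - mF"
    by (simp add: js_def avg_marg_diff avg_marg_divide avg_marg_add m_def mF_def)
  \<comment> \<open>The only loss, incurred twice with weight 2/3: averaging out Alice's tail hides
    part of Bob's first bit, and averaging out Bob's first bit hides the same amount about Alice's
    tail. The rest is an identity between \<open>xlnx\<close> terms.\<close>
  have "avg_marg n (\<lambda>b. js (g False False b) (g False True b))
      \<le> avg_disj n (\<lambda>a b. js (slice False False f a b) (slice False True f a b))"
    unfolding avg_disj_def g_def by (intro avg_marg_mono avg_cond_js) (simp_all add: slice_def f)
  also have "\<dots> = (e False False + e False True) / 2 - x"
    by (simp add: js_def avg_disj_diff avg_disj_add avg_disj_divide e_def x_def slice_mix_def)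
  finally show ?thesis unfolding full i1 i2 avg_marg_add j2 unfolding j1 by argo
qed

text \<open>The mass defects of \<open>cut_paste_bound\<close> collected over all coordinates.\<close>
primrec cut_term :: "nat \<Rightarrow> (bool list \<Rightarrow> bool list \<Rightarrow> real) \<Rightarrow> real" where
  "cut_term 0 f = 0"
| "cut_term (Suc n) f = 2 / 3 * cut_term n (slice_mix f) + 1 / 3 * cut_term n (slice True False f)
    + 5 / 72 * (avg_disj n (slice False False f) + avg_disj n (slice True True f)
      - avg_disj n (slice False True f) - avg_disj n (slice True False f))"

text \<open>Overwriting instead of inserting a coordinate matches \<open>D_SI\<close> and keeps the
  length at \<open>n\<close>: \<open>avg_disj n (plant t f)\<close> is the mean for target
  \<open>t\<close>, and planting \<open>s\<close> as well gives the intersection {s, t}.\<close>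

definition plant :: "nat \<Rightarrow> (bool list \<Rightarrow> bool list \<Rightarrow> real) \<Rightarrow> bool list \<Rightarrow> bool list \<Rightarrow> real" where
  "plant t f a b = f (a[t := True]) (b[t := True])"

text \<open>The same law read from Alice's side: her first bit is 0 with probability 2/3, and then
  Bob's is uniform.\<close>

lemma avg_disj_Suc_mix:
  "avg_disj (Suc n) f = 2 / 3 * avg_disj n (slice_mix f) + 1 / 3 * avg_disj n (slice True False f)"
  unfolding avg_disj_Suc slice_mix_def[abs_def] slice_def[abs_def] avg_disj_add avg_disj_divide
  by simp

text \<open>Each summand belongs to one coordinate. The first is paid for by the two
  \<open>js\<close> terms of \<open>disj_info_Suc\<close>; the others come from the induction
  hypotheses, because planting behind the first coordinate commutes with slicing and
  \<open>hell\<close> is convex. The weight 2/3 turns the constants 1/16 and 5/48 of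
  \<open>cut_paste_bound\<close> into 1/24 and the 5/72 of \<open>cut_term\<close>.\<close>

lemma disj_info_lower_bound:
  assumes "\<And>a b. 0 \<le> f a b" "\<And>a a' b b'. f a b * f a' b' = f a b' * f a' b"
  shows "(\<Sum>s<n. hell (avg_disj n f) (avg_disj n (plant s f))) / 24 - cut_term n f \<le> disj_info n f"
  using assms
proof (induction n arbitrary: f)
  case 0
  then show ?case by (simp add: disj_info_def ent_marg_def avg_disj_0)
next
  case (Suc n)
  note nn = Suc.prems(1) and rect = Suc.prems(2)
  define g where "g = (\<lambda>c d b. avg_cond b (\<lambda>a. slice c d f a b))"
  have g0: "0 \<le> g c d b" for c d b
    by (simp add: g_def avg_cond_nonneg nn slice_def)
  have avg_g: "avg_marg n (g c d) = avg_disj n (slice c d f)" for c d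
    by (simp add: g_def avg_disj_def)
  let ?f1 = "slice_mix f" and ?f2 = "slice True False f"
  have IH1: "(\<Sum>s<n. hell (avg_disj n ?f1) (avg_disj n (plant s ?f1))) / 24 - cut_term n ?f1 \<le> disj_info n ?f1"
  proof (rule Suc.IH)
    fix a a' b b'
    show "0 \<le> ?f1 a b" by (simp add: slice_mix_def slice_def nn)
    \<comment> \<open>Multiplying out \<open>slice_mix\<close> also yields products with different
      first bits of Bob; each of these bits travels with its own vector of Bob when the vectors are
      exchanged.\<close>
    have "slice False c f a b * slice False d f a' b' = slice False d f a b' * slice False c f a' b" for c d
      unfolding slice_def by (rule rect)
    from this[of False False] this[of False True] this[of True False] this[of True True]
    show "?f1 a b * ?f1 a' b' = ?f1 a b' * ?f1 a' b"
      by (simp add: slice_mix_def field_simps)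
  qed
  have IH2: "(\<Sum>s<n. hell (avg_disj n ?f2) (avg_disj n (plant s ?f2))) / 24 - cut_term n ?f2 \<le> disj_info n ?f2"
    by (rule Suc.IH) (simp_all only: slice_def nn, rule rect)
  have tail: "hell (avg_disj (Suc n) f) (avg_disj (Suc n) (plant (Suc s) f))
      \<le> 2/3 * hell (avg_disj n ?f1) (avg_disj n (plant s ?f1)) + 1/3 * hell (avg_disj n ?f2) (avg_disj n (plant s ?f2))" for s
  proof -
    have sl: "slice_mix (plant (Suc s) f) = plant s ?f1" "slice True False (plant (Suc s) f) = plant s ?f2"
      by (auto simp: slice_mix_def slice_def plant_def fun_eq_iff)
    have pos: "0 \<le> avg_disj n ?f1" "0 \<le> avg_disj n ?f2"
      "0 \<le> avg_disj n (plant s ?f1)" "0 \<le> avg_disj n (plant s ?f2)"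
      by (intro avg_disj_nonneg; simp add: slice_mix_def slice_def plant_def nn)+
    show ?thesis unfolding avg_disj_Suc_mix sl
      using hell_add[of "2/3 * avg_disj n ?f1" "2/3 * avg_disj n (plant s ?f1)"
          "1/3 * avg_disj n ?f2" "1/3 * avg_disj n (plant s ?f2)"]
        hell_scale[of "2/3" "avg_disj n ?f1" "avg_disj n (plant s ?f1)"]
        hell_scale[of "1/3" "avg_disj n ?f2" "avg_disj n (plant s ?f2)"] pos
      by simp
  qed
  have head: "hell (avg_disj (Suc n) f) (avg_disj (Suc n) (plant 0 f))
      \<le> avg_marg n (\<lambda>b. (hell (g False False b) (g True True b) + hell (g False True b) (g True True b)
          + hell (g True False b) (g True True b)) / 3)"
  proof -
    have "avg_disj (Suc n) f = avg_marg n (\<lambda>b. (g False False b + g False True b + g True False b) / 3)"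
      unfolding avg_marg_divide avg_marg_add avg_g by (simp add: avg_disj_Suc slice_def[abs_def])
    moreover have "avg_disj (Suc n) (plant 0 f) = avg_marg n (g True True)"
      by (simp add: avg_disj_Suc avg_g slice_def[abs_def] plant_def)
    \<comment> \<open>Writing \<open>w\<close> as the mean of three copies of itself brings
      subadditivity into play.\<close>
    moreover have "hell ((x + y + z) / 3) w \<le> (hell x w + hell y w + hell z w) / 3"
      if "0 \<le> x" "0 \<le> y" "0 \<le> z" "0 \<le> w" for x y z w
    proof -
      have "hell (1/3 * (x + y + z)) (1/3 * (w + w + w)) = 1/3 * hell (x + y + z) (w + w + w)"
        by (rule hell_scale) simp
      moreover have "hell (x + y + z) (w + w + w) \<le> hell (x + y) (w + w) + hell z w"
        by (rule hell_add) (use that in auto)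
      moreover have "hell (x + y) (w + w) \<le> hell x w + hell y w"
        by (rule hell_add) (use that in auto)
      ultimately show ?thesis by simp
    qed
    then have "avg_marg n (\<lambda>b. hell ((g False False b + g False True b + g True False b) / 3) (g True True b))
      \<le> avg_marg n (\<lambda>b. (hell (g False False b) (g True True b) + hell (g False True b) (g True True b)
          + hell (g True False b) (g True True b)) / 3)"
      by (intro avg_marg_mono) (simp add: g0)
    moreover have "hell (avg_marg n (\<lambda>b. (g False False b + g False True b + g True False b) / 3)) (avg_marg n (g True True))
      \<le> avg_marg n (\<lambda>b. hell ((g False False b + g False True b + g True False b) / 3) (g True True b))"
      by (rule avg_marg_hell) (simp_all add: g0)
    ultimately show ?thesis by simp
  qed
  have "avg_marg n (\<lambda>b. ((hell (g False False b) (g True True b) + hell (g False True b) (g True True b)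
          + hell (g True False b) (g True True b)) / 3
          - 5/3 * (g False False b + g True True b - g False True b - g True False b)) / 16)
      \<le> avg_marg n (\<lambda>b. js (g False False b) (g True False b) + js (g False False b) (g False True b))"
  proof (intro avg_marg_mono cut_paste_bound g0)
    fix b
    \<comment> \<open>With Bob's tail \<open>b\<close> fixed only Alice's tail has been averaged, so
      the two-by-two matrix in the first bits has rank one.\<close>
    show "g False False b * g True True b = g False True b * g True False b"
      unfolding g_def by (rule avg_cond_mult_cong) (simp add: slice_def, rule rect)
  qed
  then have js: "(hell (avg_disj (Suc n) f) (avg_disj (Suc n) (plant 0 f))
        - 5/3 * (avg_disj n (slice False False f) + avg_disj n (slice True True f)
      - avg_disj n (slice False True f) - avg_disj n (slice True False f))) / 16
     \<le> avg_marg n (\<lambda>b. js (g False False b) (g True False b) + js (g False False b) (g False True b))"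
    using head unfolding avg_marg_divide avg_marg_diff avg_marg_cmult avg_marg_add avg_g by argo
  have "(\<Sum>s<Suc n. hell (avg_disj (Suc n) f) (avg_disj (Suc n) (plant s f)))
      \<le> hell (avg_disj (Suc n) f) (avg_disj (Suc n) (plant 0 f)) +
       (2/3 * (\<Sum>s<n. hell (avg_disj n ?f1) (avg_disj n (plant s ?f1)))
        + 1/3 * (\<Sum>s<n. hell (avg_disj n ?f2) (avg_disj n (plant s ?f2))))"
    unfolding sum.lessThan_Suc_shift sum_distrib_left sum.distrib[symmetric]
    by (intro add_left_mono sum_mono tail)
  moreover have "2 / 3 * disj_info n ?f1 + 1 / 3 * disj_info n ?f2
    + 2 / 3 * avg_marg n (\<lambda>b. js (g False False b) (g True False b) + js (g False False b) (g False True b))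
    \<le> disj_info (Suc n) f"
    using disj_info_Suc[of f n, OF nn] by (simp add: g_def)
  ultimately show ?case
    using js IH1 IH2 unfolding cut_term.simps by argo
qed

section \<open>The set intersection distribution\<close>

abbreviation disj_law :: "(bool \<times> bool) pmf" where
  "disj_law \<equiv> pmf_of_set {(False, False), (False, True), (True, False)}"

lemma finite_set_replicate_pmf: "finite (set_pmf p) \<Longrightarrow> finite (set_pmf (replicate_pmf n p))"
  by (simp add: set_replicate_pmf lists_eq_set finite_lists_length_eq)

lemma expectation_replicate_disj_law:
  "measure_pmf.expectation (replicate_pmf n disj_law) (\<lambda>xs. f (map fst xs) (map snd xs)) = avg_disj n f"
proof (induction n arbitrary: f)
  case 0
  then show ?case by (simp add: avg_disj_0)
next
  case (Suc n)
  have fin: "finite (set_pmf (replicate_pmf n disj_law))"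
    by (rule finite_set_replicate_pmf) simp
  have "measure_pmf.expectation (replicate_pmf (Suc n) disj_law) (\<lambda>xs. f (map fst xs) (map snd xs))
     = (\<Sum>z\<in>{(False, False), (False, True), (True, False)}. pmf disj_law z *\<^sub>R
        measure_pmf.expectation (replicate_pmf n disj_law) (\<lambda>xs. f (fst z # map fst xs) (snd z # map snd xs)))"
    unfolding replicate_pmf.simps map_pmf_def[symmetric]
    by (subst pmf_expectation_bind[where A = "{(False, False), (False, True), (True, False)}"])
      (use fin in \<open>simp_all add: set_pmf_of_set\<close>)
  also have "\<dots> = avg_disj (Suc n) f"
    by (simp add: Suc[of "\<lambda>a b. f (c # a) (d # b)" for c d] avg_disj_Suc)
  finally show ?case .
qed

lemma D_SI_eq:
  "D_SI n = replicate_pmf n disj_law \<bind> (\<lambda>xs. map_pmf (\<lambda>t. (map fst (xs[t := (True, True)]), map snd (xs[t := (True, True)]))) (pmf_of_set {..<n}))"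
  by (simp add: D_SI_def map_pmf_def Let_def)

lemma finite_set_D_SI: "1 \<le> n \<Longrightarrow> finite (set_pmf (D_SI n))"
  unfolding D_SI_eq using lessThan_empty_iff[of n]
  by (auto intro!: finite_set_replicate_pmf finite_imageI simp: set_pmf_of_set bot_nat_def)

lemma length_D_SI:
  assumes "z \<in> set_pmf (D_SI n)"
  shows "length (fst z) = n \<and> length (snd z) = n"
proof -
  obtain xs t where "xs \<in> set_pmf (replicate_pmf n disj_law)"
    "z = (map fst (xs[t := (True, True)]), map snd (xs[t := (True, True)]))"
    using assms unfolding D_SI_eq set_bind_pmf set_map_pmf by blast
  then show ?thesis by (simp add: set_replicate_pmf)
qed

lemma target_D_SI:
  assumes "1 \<le> n" "xs \<in> set_pmf (replicate_pmf n disj_law)" "t < n"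
  shows "target (map fst (xs[t := (True, True)])) (map snd (xs[t := (True, True)])) = t"
proof -
  have len: "length xs = n" and xs: "\<And>i. i < n \<Longrightarrow> xs ! i \<in> {(False, False), (False, True), (True, False)}"
    using assms(2) by (auto simp: set_replicate_pmf lists_eq_set dest: nth_mem)
  show ?thesis unfolding target_def
  proof (rule the_equality)
    fix i assume "i < length (map fst (xs[t := (True, True)])) \<and> map fst (xs[t := (True, True)]) ! i \<and> map snd (xs[t := (True, True)]) ! i"
    then show "i = t" using xs[of i] len assms(3) by (auto simp: nth_list_update split: if_splits)
  qed (use len assms in auto)
qed

lemma expectation_D_SI:
  assumes "1 \<le> n"
  shows "measure_pmf.expectation (D_SI n) (\<lambda>z. h (fst z) (snd z)) = (\<Sum>t<n. avg_disj n (plant t h)) / n"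
proof -
  let ?X = "set_pmf (replicate_pmf n disj_law)"
  have fin: "finite ?X" by (rule finite_set_replicate_pmf) simp
  have ne: "{..<n} \<noteq> {}" using assms lessThan_empty_iff[of n] by (simp add: bot_nat_def)
  have "measure_pmf.expectation (D_SI n) (\<lambda>z. h (fst z) (snd z)) =
      (\<Sum>xs\<in>?X. pmf (replicate_pmf n disj_law) xs *\<^sub>R
        ((\<Sum>t<n. plant t h (map fst xs) (map snd xs)) / n))"
    unfolding D_SI_eq
    by (subst pmf_expectation_bind[OF fin])
      (use ne in \<open>auto simp: integral_pmf_of_set plant_def map_update set_pmf_of_set\<close>)
  also have "\<dots> = measure_pmf.expectation (replicate_pmf n disj_law) (\<lambda>xs. (\<Sum>t<n. plant t h (map fst xs) (map snd xs)) / n)"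
    by (subst integral_measure_pmf_real[OF fin]) (auto simp: mult.commute)
  also have "\<dots> = (\<Sum>t<n. measure_pmf.expectation (replicate_pmf n disj_law) (\<lambda>xs. plant t h (map fst xs) (map snd xs))) / n"
    by (subst Bochner_Integration.integral_divide_zero, subst Bochner_Integration.integral_sum)
      (auto intro: integrable_measure_pmf_finite fin)
  finally show ?thesis by (simp add: expectation_replicate_disj_law)
qed

lemma expectation_D_SI_target:
  assumes "1 \<le> n" "t < n"
  shows "measure_pmf.expectation (D_SI n) (\<lambda>z. of_bool (target (fst z) (snd z) = t) * h (fst z) (snd z))
    = avg_disj n (plant t h) / n"
proof -
  let ?X = "set_pmf (replicate_pmf n disj_law)"
  have fin: "finite ?X" by (rule finite_set_replicate_pmf) simp
  have ne: "{..<n} \<noteq> {}" using assms lessThan_empty_iff[of n] by (simp add: bot_nat_def)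
  have inner: "(\<Sum>s<n. of_bool (target (map fst (xs[s := (True, True)])) (map snd (xs[s := (True, True)])) = t)
      * h (map fst (xs[s := (True, True)])) (map snd (xs[s := (True, True)]))) / n
     = plant t h (map fst xs) (map snd xs) / n" if "xs \<in> ?X" for xs
  proof -
    have "(\<Sum>s<n. of_bool (target (map fst (xs[s := (True, True)])) (map snd (xs[s := (True, True)])) = t)
      * h (map fst (xs[s := (True, True)])) (map snd (xs[s := (True, True)])))
      = (\<Sum>s<n. if s = t then plant t h (map fst xs) (map snd xs) else 0)"
      using target_D_SI[OF assms(1) that] by (intro sum.cong) (auto simp: plant_def map_update)
    then show ?thesis using assms by simp
  qed
  have "measure_pmf.expectation (D_SI n) (\<lambda>z. of_bool (target (fst z) (snd z) = t) * h (fst z) (snd z)) =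
      (\<Sum>xs\<in>?X. pmf (replicate_pmf n disj_law) xs *\<^sub>R
        ((\<Sum>s<n. of_bool (target (map fst (xs[s := (True, True)])) (map snd (xs[s := (True, True)])) = t)
      * h (map fst (xs[s := (True, True)])) (map snd (xs[s := (True, True)]))) / n))"
    unfolding D_SI_eq
    by (subst pmf_expectation_bind[OF fin])
      (use ne in \<open>auto simp: integral_pmf_of_set set_pmf_of_set\<close>)
  also have "\<dots> = (\<Sum>xs\<in>?X. (plant t h (map fst xs) (map snd xs) / n) * pmf (replicate_pmf n disj_law) xs)"
    by (intro sum.cong) (simp_all only: inner, simp add: mult.commute)
  also have "\<dots> = measure_pmf.expectation (replicate_pmf n disj_law) (\<lambda>xs. plant t h (map fst xs) (map snd xs) / n)"
    by (rule integral_measure_pmf_real[OF fin, symmetric]) auto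
  also have "\<dots> = avg_disj n (plant t h) / n"
    by (simp add: expectation_replicate_disj_law)
  finally show ?thesis .
qed

section \<open>Transcript information about a function of the input\<close>

definition cell_prob :: "'a pmf \<Rightarrow> ('a \<Rightarrow> 'c) \<Rightarrow> 'c \<Rightarrow> real" where
  "cell_prob D k y = measure_pmf.expectation D (\<lambda>z. of_bool (k z = y))"

text \<open>If \<open>h z\<close> is the probability of a transcript on input \<open>z\<close>, this
  is its joint probability with the event \<open>k z = y\<close>; divided by
  \<open>cell_prob\<close> it becomes the conditional one.\<close>

definition cell_mass :: "'a pmf \<Rightarrow> ('a \<Rightarrow> 'c) \<Rightarrow> ('a \<Rightarrow> real) \<Rightarrow> 'c \<Rightarrow> real" where
  "cell_mass D k h y = measure_pmf.expectation D (\<lambda>z. of_bool (k z = y) * h z)"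

text \<open>\<open>ent_given D k h\<close> minus \<open>xlnx\<close> of the mean of \<open>h\<close> is the contribution of one transcript to
  \<open>I(\<Pi>; k(A, B))\<close>, in nats, when \<open>h z\<close> is its probability on input \<open>z\<close>.\<close>
definition ent_given :: "'a pmf \<Rightarrow> ('a \<Rightarrow> 'c) \<Rightarrow> ('a \<Rightarrow> real) \<Rightarrow> real" where
  "ent_given D k h = (\<Sum>y\<in>k ` set_pmf D. cell_prob D k y * xlnx (cell_mass D k h y / cell_prob D k y))"

lemma cell_prob_outside: "y \<notin> k ` set_pmf D \<Longrightarrow> cell_prob D k y = 0"
  unfolding cell_prob_def
  by (subst integral_cong_AE[where g = "\<lambda>_. 0"]) (auto simp: AE_measure_pmf_iff)

lemma ent_given_superset:
  assumes "finite Y" "k ` set_pmf D \<subseteq> Y"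
  shows "ent_given D k h = (\<Sum>y\<in>Y. cell_prob D k y * xlnx (cell_mass D k h y / cell_prob D k y))"
  unfolding ent_given_def using assms by (intro sum.mono_neutral_left) (auto simp: cell_prob_outside)

lemma cell_mass_inj:
  assumes "finite (set_pmf D)" "inj_on k (set_pmf D)" "z \<in> set_pmf D"
  shows "cell_mass D k h (k z) = pmf D z * h z"
proof -
  have "cell_mass D k h (k z) = (\<Sum>x\<in>set_pmf D. (of_bool (k x = k z) * h x) * pmf D x)"
    unfolding cell_mass_def by (subst integral_measure_pmf_real[OF assms(1)]) auto
  also have "\<dots> = (\<Sum>x\<in>set_pmf D. if x = z then pmf D z * h z else 0)"
    using assms by (intro sum.cong) (auto dest: inj_onD)
  finally show ?thesis using assms by simp
qed

lemma cell_prob_eq_mass: "cell_prob D k y = cell_mass D k (\<lambda>_. 1) y"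
  by (simp add: cell_prob_def cell_mass_def)

text \<open>Each cell holds a single input, so nothing is averaged inside
  \<open>xlnx\<close>.\<close>

lemma ent_given_inj:
  assumes "finite (set_pmf D)" "inj_on k (set_pmf D)"
  shows "ent_given D k h = measure_pmf.expectation D (\<lambda>z. xlnx (h z))"
proof -
  have "ent_given D k h = (\<Sum>z\<in>set_pmf D. pmf D z * xlnx (pmf D z * h z / pmf D z))"
    unfolding ent_given_def using assms
    by (subst sum.reindex) (auto simp: cell_prob_eq_mass cell_mass_inj)
  also have "\<dots> = (\<Sum>z\<in>set_pmf D. xlnx (h z) * pmf D z)"
    by (intro sum.cong) (auto simp: set_pmf_iff)
  also have "\<dots> = measure_pmf.expectation D (\<lambda>z. xlnx (h z))"
    by (subst integral_measure_pmf_real[OF assms(1)]) auto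
  finally show ?thesis .
qed

section \<open>Revealing the target by convexity\<close>

lemma avg_marg_eq_sum:
  "\<exists>w. (\<forall>b. 0 \<le> w b) \<and> (\<forall>h. avg_marg n h = (\<Sum>b | length b = n. w b * h b))"
proof (induction n)
  case 0
  show ?case by (rule exI[of _ "\<lambda>_. 1"]) simp
next
  case (Suc n)
  then obtain w where w: "\<And>b. 0 \<le> w b" "\<And>h. avg_marg n h = (\<Sum>b | length b = n. w b * h b)" by blast
  define v where "v = (\<lambda>b. (if hd b then 1/3 else 2/3) * w (tl b))"
  have "avg_marg (Suc n) h = (\<Sum>b | length b = Suc n. v b * h b)" for h
  proof -
    have fin: "finite {b :: bool list. length b = n}"
      using finite_lists_length_eq[of "UNIV :: bool set" n] by simp
    have "{b :: bool list. length b = Suc n} = (#) False ` {b. length b = n} \<union> (#) True ` {b. length b = n}"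
      by (auto simp: length_Suc_conv image_iff)
    then have "(\<Sum>b | length b = Suc n. v b * h b) =
        (\<Sum>b\<in>(#) False ` {b. length b = n}. v b * h b) + (\<Sum>b\<in>(#) True ` {b. length b = n}. v b * h b)"
      by (simp only:) (rule sum.union_disjoint, use fin in auto)
    also have "\<dots> = (\<Sum>b | length b = n. v (False # b) * h (False # b)) + (\<Sum>b | length b = n. v (True # b) * h (True # b))"
      by (subst (1 2) sum.reindex) (auto simp: inj_on_def)
    also have "\<dots> = avg_marg (Suc n) h"
      by (simp add: v_def w(2) sum_distrib_left mult.assoc)
    finally show ?thesis by simp
  qed
  moreover have "0 \<le> v b" for b by (simp add: v_def w)
  ultimately show ?case by blast
qed

text \<open>Several pairs of a target \<open>t\<close> and a vector \<open>b\<close> lead to the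
  same planted vector \<open>y\<close>. Jensen is applied within each such fibre, and the fibres
  partition all pairs.\<close>

lemma avg_marg_jensen:
  fixes g :: "nat \<Rightarrow> bool list \<Rightarrow> real"
  assumes "1 \<le> n" and g: "\<And>t b. 0 \<le> g t b"
    and P: "\<And>y. P y = (\<Sum>t<n. avg_marg n (\<lambda>b. of_bool (b[t := True] = y))) / n"
    and q: "\<And>y. q y = (\<Sum>t<n. avg_marg n (\<lambda>b. of_bool (b[t := True] = y) * g t b)) / n"
  shows "(\<Sum>y | length y = n. P y * xlnx (q y / P y)) \<le> (\<Sum>t<n. avg_marg n (\<lambda>b. xlnx (g t b))) / n"
proof -
  obtain w where w: "\<And>b. 0 \<le> w b" "\<And>h. avg_marg n h = (\<Sum>b | length b = n. w b * h b)"
    using avg_marg_eq_sum by blast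
  define L where "L = {b :: bool list. length b = n}"
  have fin: "finite L"
    using finite_lists_length_eq[of "UNIV :: bool set" n] by (simp add: L_def)
  define I where "I = (\<lambda>y. {i \<in> {..<n} \<times> L. (snd i)[fst i := True] = y})"
  have finI: "finite (I y)" for y using fin by (simp add: I_def)
  have sum_I: "(\<Sum>t<n. avg_marg n (\<lambda>b. of_bool (b[t := True] = y) * h t b)) / n = (\<Sum>i\<in>I y. w (snd i) / n * h (fst i) (snd i))" for y h
  proof -
    have "(\<Sum>t<n. avg_marg n (\<lambda>b. of_bool (b[t := True] = y) * h t b)) / n
      = (\<Sum>i\<in>{..<n} \<times> L. if (snd i)[fst i := True] = y then w (snd i) / n * h (fst i) (snd i) else 0)"
      unfolding w(2) L_def[symmetric] sum.cartesian_product sum_divide_distrib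
      by (intro sum.cong) auto
    also have "\<dots> = (\<Sum>i\<in>I y. w (snd i) / n * h (fst i) (snd i))"
      unfolding I_def by (rule sum.inter_filter[symmetric]) (use fin in auto)
    finally show ?thesis .
  qed
  have P': "P y = (\<Sum>i\<in>I y. w (snd i) / n)" for y
    using sum_I[of y "\<lambda>_ _. 1"] by (simp add: P)
  have q': "q y = (\<Sum>i\<in>I y. w (snd i) / n * g (fst i) (snd i))" for y
    unfolding q by (rule sum_I)
  have "(\<Sum>y\<in>L. P y * xlnx (q y / P y)) \<le> (\<Sum>y\<in>L. \<Sum>i\<in>I y. w (snd i) / n * xlnx (g (fst i) (snd i)))"
    unfolding P' q' by (intro sum_mono sum_xlnx_jensen) (auto simp: finI w g)
  also have "\<dots> = (\<Sum>i\<in>{..<n} \<times> L. w (snd i) / n * xlnx (g (fst i) (snd i)))"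
    unfolding I_def by (rule sum.group) (use fin in \<open>auto simp: L_def\<close>)
  also have "\<dots> = (\<Sum>t<n. avg_marg n (\<lambda>b. xlnx (g t b))) / n"
    unfolding w(2) L_def[symmetric] sum_divide_distrib sum.cartesian_product
    by (intro sum.cong) auto
  finally show ?thesis by (simp add: L_def)
qed

text \<open>The target is a function of both inputs, so revealing it together with Bob's set only
  lowers the information about Alice's set; in terms of entropies this is convexity of
  \<open>xlnx\<close> over the targets compatible with Bob's set.\<close>

lemma ent_given_snd_D_SI:
  assumes n: "1 \<le> n" and f: "\<And>a b. 0 \<le> f a b"
  shows "ent_given (D_SI n) snd (\<lambda>z. f (fst z) (snd z)) \<le> (\<Sum>t<n. ent_marg n (plant t f)) / n"
proof -
  have fin: "finite {y :: bool list. length y = n}"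
    using finite_lists_length_eq[of "UNIV :: bool set" n] by simp
  have "ent_given (D_SI n) snd (\<lambda>z. f (fst z) (snd z)) = (\<Sum>y | length y = n. cell_prob (D_SI n) snd y *
      xlnx (cell_mass (D_SI n) snd (\<lambda>z. f (fst z) (snd z)) y / cell_prob (D_SI n) snd y))"
    by (rule ent_given_superset[OF fin]) (use length_D_SI in auto)
  also have "\<dots> \<le> (\<Sum>t<n. avg_marg n (\<lambda>b. xlnx (avg_cond b (\<lambda>a. plant t f a b)))) / n"
  proof (rule avg_marg_jensen[OF n])
    show "cell_prob (D_SI n) snd y = (\<Sum>t<n. avg_marg n (\<lambda>b. of_bool (b[t := True] = y))) / n" for y
      unfolding cell_prob_def using expectation_D_SI[OF n, of "\<lambda>a b. of_bool (b = y)"]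
      by (simp add: plant_def avg_disj_def avg_cond_const)
    show "cell_mass (D_SI n) snd (\<lambda>z. f (fst z) (snd z)) y =
       (\<Sum>t<n. avg_marg n (\<lambda>b. of_bool (b[t := True] = y) * avg_cond b (\<lambda>a. plant t f a b))) / n" for y
      unfolding cell_mass_def using expectation_D_SI[OF n, of "\<lambda>a b. of_bool (b = y) * f a b"]
      by (simp add: plant_def avg_disj_def avg_cond_cmult)
  qed (simp add: avg_cond_nonneg plant_def f)
  finally show ?thesis by (simp add: ent_marg_def)
qed

lemma ent_given_fst_D_SI:
  assumes n: "1 \<le> n" and f: "\<And>a b. 0 \<le> f a b"
  shows "ent_given (D_SI n) fst (\<lambda>z. f (fst z) (snd z)) \<le> (\<Sum>t<n. ent_marg n (\<lambda>a b. plant t f b a)) / n"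
proof -
  have sw: "measure_pmf.expectation (D_SI n) (\<lambda>z. h (fst z) (snd z)) =
     measure_pmf.expectation (D_SI n) (\<lambda>z. h (snd z) (fst z))" for h :: "bool list \<Rightarrow> bool list \<Rightarrow> real"
  proof -
    have "avg_disj n (plant t (\<lambda>a b. h b a)) = avg_disj n (plant t h)" for t
      unfolding plant_def[abs_def] by (rule avg_disj_swap)
    then show ?thesis
      unfolding expectation_D_SI[OF n, of h] expectation_D_SI[OF n, of "\<lambda>a b. h b a"] by simp
  qed
  have fin: "finite {y :: bool list. length y = n}"
    using finite_lists_length_eq[of "UNIV :: bool set" n] by simp
  have P: "cell_prob (D_SI n) fst y = cell_prob (D_SI n) snd y" for y
    unfolding cell_prob_def using sw[of "\<lambda>a b. of_bool (a = y)"] by simp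
  have q: "cell_mass (D_SI n) fst (\<lambda>z. f (fst z) (snd z)) y = cell_mass (D_SI n) snd (\<lambda>z. f (snd z) (fst z)) y" for y
    unfolding cell_mass_def using sw[of "\<lambda>a b. of_bool (a = y) * f a b"] by simp
  have "ent_given (D_SI n) fst (\<lambda>z. f (fst z) (snd z)) = (\<Sum>y | length y = n. cell_prob (D_SI n) fst y *
      xlnx (cell_mass (D_SI n) fst (\<lambda>z. f (fst z) (snd z)) y / cell_prob (D_SI n) fst y))"
    by (rule ent_given_superset[OF fin]) (use length_D_SI in auto)
  also have "\<dots> = ent_given (D_SI n) snd (\<lambda>z. f (snd z) (fst z))"
    unfolding P q by (rule ent_given_superset[OF fin, symmetric]) (use length_D_SI in auto)
  also have "\<dots> \<le> (\<Sum>t<n. ent_marg n (plant t (\<lambda>a b. f b a))) / n"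
    using ent_given_snd_D_SI[OF n, of "\<lambda>a b. f b a"] f by simp
  finally show ?thesis by (simp add: plant_def[abs_def])
qed

text \<open>Both coordinates are compared with the law in which the two of them intersect.\<close>
lemma set_int_info_lower_bound:
  fixes f :: "bool list \<Rightarrow> bool list \<Rightarrow> real"
  assumes n: "1 \<le> n" and f: "\<And>a b. 0 \<le> f a b"
    and rect: "\<And>a a' b b'. f a b * f a' b' = f a b' * f a' b"
  shows "(\<Sum>s<n. \<Sum>t<n. hell (avg_disj n (plant s f)) (avg_disj n (plant t f))) / (96 * n)
      - (\<Sum>t<n. cut_term n (plant t f)) / n
    \<le> 2 * measure_pmf.expectation (D_SI n) (\<lambda>z. xlnx (f (fst z) (snd z)))
      - ent_given (D_SI n) snd (\<lambda>z. f (fst z) (snd z))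
      - ent_given (D_SI n) fst (\<lambda>z. f (fst z) (snd z))"
proof -
  define \<nu> where "\<nu> = (\<lambda>t. avg_disj n (plant t f))"
  define \<rho> where "\<rho> = (\<lambda>s t. avg_disj n (plant s (plant t f)))"
  have \<rho>: "\<rho> s t = \<rho> t s" for s t
    unfolding \<rho>_def by (rule arg_cong[where f = "avg_disj n"])
      (cases "s = t"; auto simp: plant_def fun_eq_iff list_update_swap)
  have "(\<Sum>s<n. \<Sum>t<n. hell (\<nu> s) (\<nu> t)) \<le> (\<Sum>s<n. \<Sum>t<n. 2 * hell (\<nu> s) (\<rho> t s) + 2 * hell (\<nu> t) (\<rho> s t))"
    by (intro sum_mono) (metis \<rho> hell_commute hell_triangle)
  also have "\<dots> = 4 * (\<Sum>t<n. \<Sum>s<n. hell (\<nu> t) (\<rho> s t))"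
  proof -
    have "(\<Sum>s<n. \<Sum>t<n. hell (\<nu> t) (\<rho> s t)) = (\<Sum>t<n. \<Sum>s<n. hell (\<nu> t) (\<rho> s t))"
      by (rule sum.swap)
    then show ?thesis unfolding sum.distrib sum_distrib_left[symmetric] by linarith
  qed
  \<comment> \<open>Both terms of \<open>hell_triangle\<close> carry a factor 2 and have equal
    double sums; the resulting 4 turns 24 into 96.\<close>
  finally have tri: "(\<Sum>s<n. \<Sum>t<n. hell (\<nu> s) (\<nu> t)) / 96 \<le> (\<Sum>t<n. (\<Sum>s<n. hell (\<nu> t) (\<rho> s t)) / 24)"
    by (simp flip: sum_divide_distrib)
  \<comment> \<open>Coordinate \<open>t\<close> of \<open>plant t f\<close> has no influence, and
    its summand \<open>s = t\<close> is zero, so there is no need to delete it.\<close>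
  have "(\<Sum>s<n. hell (\<nu> t) (\<rho> s t)) / 24 - cut_term n (plant t f) \<le> disj_info n (plant t f)" for t
    unfolding \<nu>_def \<rho>_def
    by (rule disj_info_lower_bound) (simp_all only: plant_def f, rule rect)
  then have "(\<Sum>t<n. (\<Sum>s<n. hell (\<nu> t) (\<rho> s t)) / 24 - cut_term n (plant t f)) \<le> (\<Sum>t<n. disj_info n (plant t f))"
    by (intro sum_mono)
  with tri have "((\<Sum>s<n. \<Sum>t<n. hell (\<nu> s) (\<nu> t)) / 96 - (\<Sum>t<n. cut_term n (plant t f))) / n
     \<le> (\<Sum>t<n. disj_info n (plant t f)) / n"
    by (intro divide_right_mono) (auto simp: sum_subtractf)
  also have "\<dots> = 2 * measure_pmf.expectation (D_SI n) (\<lambda>z. xlnx (f (fst z) (snd z)))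
     - (\<Sum>t<n. ent_marg n (plant t f)) / n - (\<Sum>t<n. ent_marg n (\<lambda>a b. plant t f b a)) / n"
    unfolding disj_info_def expectation_D_SI[OF n, of "\<lambda>a b. xlnx (f a b)"]
    by (simp add: plant_def[abs_def] sum_subtractf diff_divide_distrib flip: sum_distrib_left)
  also have "\<dots> \<le> 2 * measure_pmf.expectation (D_SI n) (\<lambda>z. xlnx (f (fst z) (snd z)))
      - ent_given (D_SI n) snd (\<lambda>z. f (fst z) (snd z))
      - ent_given (D_SI n) fst (\<lambda>z. f (fst z) (snd z))"
    using ent_given_snd_D_SI[of n f, OF n f] ent_given_fst_D_SI[of n f, OF n f] by linarith
  finally show ?thesis by (simp add: \<nu>_def diff_divide_distrib)
qed

section \<open>The density of the transcript\<close>

text \<open>Each bit sent constrains the input and private string of its owner alone, so the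
  executions with given messages form a rectangle.\<close>

lemma messages_rectangle:
  "\<exists>P Q. \<forall>x y ra rb. messages T x y ra rb = m \<longleftrightarrow> P x ra \<and> Q y rb"
proof (induction T arbitrary: m)
  case Halt
  show ?case by (rule exI[of _ "\<lambda>_ _. m = []"], rule exI[of _ "\<lambda>_ _. True"]) auto
next
  case (Alice f l r)
  show ?case
  proof (cases m)
    case Nil
    then show ?thesis by auto
  next
    case (Cons c m')
    obtain P Q where PQ: "\<And>x y ra rb. messages (if c then l else r) x y ra rb = m' \<longleftrightarrow> P x ra \<and> Q y rb"
      using Alice by (cases c) (simp, metis)+
    show ?thesis
      by (rule exI[of _ "\<lambda>x ra. f x ra = c \<and> P x ra"], rule exI[of _ Q])
        (use PQ in \<open>cases c; auto simp: Cons\<close>)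
  qed
next
  case (Bob g l r)
  show ?case
  proof (cases m)
    case Nil
    then show ?thesis by auto
  next
    case (Cons c m')
    obtain P Q where PQ: "\<And>x y ra rb. messages (if c then l else r) x y ra rb = m' \<longleftrightarrow> P x ra \<and> Q y rb"
      using Bob by (cases c) (simp, metis)+
    show ?thesis
      by (rule exI[of _ P], rule exI[of _ "\<lambda>y rb. g y rb = c \<and> Q y rb"])
        (use PQ in \<open>cases c; auto simp: Cons\<close>)
  qed
qed

text \<open>Neither factor is assumed measurable: a factor that is not forces the other one to be empty,
  and both sides vanish.\<close>
lemma measure_Times_rectangle:
  assumes "finite_measure M" "finite_measure N" "A \<times> B \<in> sets (M \<Otimes>\<^sub>M N)"
  shows "measure (M \<Otimes>\<^sub>M N) (A \<times> B) = measure M A * measure N B"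
proof (cases "A = {} \<or> B = {}")
  case False
  interpret N: finite_measure N by fact
  obtain a b where ab: "a \<in> A" "b \<in> B" using False by auto
  have "B \<in> sets N" using sets_Pair1[OF assms(3), of a] ab by (simp add: vimage_def)
  moreover have "A \<in> sets M" using sets_Pair2[OF assms(3), of b] ab by (simp add: vimage_def)
  ultimately show ?thesis
    by (simp add: measure_def N.emeasure_pair_measure_Times enn2real_mult)
qed auto

lemma distributed_realI:
  fixes f :: "'b \<Rightarrow> real"
  assumes X[measurable]: "X \<in> M \<rightarrow>\<^sub>M N" and f[measurable]: "f \<in> borel_measurable N"
    and eq: "\<And>E. E \<in> sets N \<Longrightarrow> (\<integral>\<^sup>+\<omega>. indicator E (X \<omega>) \<partial>M) = (\<integral>\<^sup>+x. ennreal (f x) * indicator E x \<partial>N)"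
  shows "distributed M N X f"
  unfolding distributed_def
proof safe
  show "distr M N X = density N (\<lambda>x. ennreal (f x))"
  proof (rule measure_eqI)
    fix E assume "E \<in> sets (distr M N X)"
    then have E[measurable]: "E \<in> sets N" by simp
    have "emeasure (distr M N X) E = (\<integral>\<^sup>+x. indicator E x \<partial>distr M N X)" by simp
    also have "\<dots> = (\<integral>\<^sup>+\<omega>. indicator E (X \<omega>) \<partial>M)" by (rule nn_integral_distr) auto
    finally show "emeasure (distr M N X) E = emeasure (density N (\<lambda>x. ennreal (f x))) E"
      by (simp add: eq emeasure_density)
  qed simp
qed (use assms in auto)

text \<open>Finite support turns expectations over the inputs into finite sums, which commute freely
  with integrals over transcripts.\<close>

locale protocol_run =
  fixes \<pi> :: "('x::countable, 'y::countable) protocol" and D :: "('x \<times> 'y) pmf"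
  assumes protocol: "is_protocol \<pi>" and finite_support: "finite (set_pmf D)"
begin

sublocale P: prob_space "public_law \<pi>" using protocol by (simp add: is_protocol_def)
sublocale A: prob_space "alice_law \<pi>" using protocol by (simp add: is_protocol_def)
sublocale B: prob_space "bob_law \<pi>" using protocol by (simp add: is_protocol_def)
sublocale AB: pair_prob_space "alice_law \<pi>" "bob_law \<pi>" ..
sublocale PAB: pair_prob_space "public_law \<pi>" "alice_law \<pi> \<Otimes>\<^sub>M bob_law \<pi>" ..
sublocale DPAB: pair_prob_space "measure_pmf D" "public_law \<pi> \<Otimes>\<^sub>M alice_law \<pi> \<Otimes>\<^sub>M bob_law \<pi>" ..

abbreviation private_law :: "(tape \<times> tape) measure" where
  "private_law \<equiv> alice_law \<pi> \<Otimes>\<^sub>M bob_law \<pi>"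

abbreviation \<Omega> :: "('x, 'y) outcome measure" where
  "\<Omega> \<equiv> execution \<pi> D"

abbreviation S :: "(tape \<times> bool list) measure" where
  "S \<equiv> transcript_space \<pi>"

sublocale \<Omega>: prob_space \<Omega>
  unfolding execution_def by (rule DPAB.prob_space_axioms)

lemma sigma_finite_S: "sigma_finite_measure S"
proof -
  interpret C: sigma_finite_measure "count_space (UNIV :: bool list set)"
    by (rule sigma_finite_measure_count_space)
  interpret pair_sigma_finite "public_law \<pi>" "count_space (UNIV :: bool list set)" ..
  show ?thesis unfolding transcript_space_def by (rule sigma_finite_measure_axioms)
qed

sublocale S: sigma_finite_measure S by (rule sigma_finite_S)

lemma measurable_messages [measurable]:
  "(\<lambda>(r, p). messages (tree \<pi> r) x y (fst p) (snd p)) \<in> public_law \<pi> \<Otimes>\<^sub>M private_law \<rightarrow>\<^sub>M count_space UNIV"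
  using protocol by (simp add: is_protocol_def case_prod_beta')

text \<open>The density of the transcript with respect to public law times counting measure.\<close>
definition dens :: "'x \<times> 'y \<Rightarrow> tape \<times> bool list \<Rightarrow> real" where
  "dens z x = measure private_law
    {p \<in> space private_law. messages (tree \<pi> (fst x)) (fst z) (snd z) (fst p) (snd p) = snd x}"

lemma dens_nonneg [simp]: "0 \<le> dens z x" by (simp add: dens_def)

lemma measurable_messages_section:
  assumes "r \<in> space (public_law \<pi>)"
  shows "(\<lambda>p. messages (tree \<pi> r) x y (fst p) (snd p)) \<in> private_law \<rightarrow>\<^sub>M count_space UNIV"
  using measurable_Pair2[OF measurable_messages assms] by simp

text \<open>The private strings are independent, so a rectangle of executions gives a product of one
  factor for each player. The restriction to \<open>space S\<close> supplies measurability of the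
  messages for the fixed public string.\<close>

lemma dens_rectangle:
  assumes x: "x \<in> space S"
  shows "dens (a, b) x * dens (a', b') x = dens (a, b') x * dens (a', b) x"
proof -
  obtain P Q where PQ: "\<And>a b ra rb. messages (tree \<pi> (fst x)) a b ra rb = snd x \<longleftrightarrow> P a ra \<and> Q b rb"
    using messages_rectangle[of "tree \<pi> (fst x)" "snd x"] by metis
  have r: "fst x \<in> space (public_law \<pi>)" using x by (auto simp: transcript_space_def space_pair_measure)
  have "dens (a, b) x = measure (alice_law \<pi>) {ra \<in> space (alice_law \<pi>). P a ra}
      * measure (bob_law \<pi>) {rb \<in> space (bob_law \<pi>). Q b rb}" for a b
  proof -
    have eq: "{p \<in> space private_law. messages (tree \<pi> (fst x)) a b (fst p) (snd p) = snd x} =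
        {ra \<in> space (alice_law \<pi>). P a ra} \<times> {rb \<in> space (bob_law \<pi>). Q b rb}"
      by (auto simp: PQ space_pair_measure)
    have "{p \<in> space private_law. messages (tree \<pi> (fst x)) a b (fst p) (snd p) = snd x} \<in> sets private_law"
      by (rule measurable_sets_Collect[OF measurable_messages_section[OF r]]) simp
    then show ?thesis unfolding dens_def fst_conv snd_conv eq
      by (intro measure_Times_rectangle A.finite_measure_axioms B.finite_measure_axioms)
  qed
  then show ?thesis by simp
qed

text \<open>For fixed messages the density is the measure of a section of a measurable set; there
  are only countably many message lists to glue together.\<close>

lemma borel_measurable_dens [measurable]: "dens z \<in> borel_measurable S"
proof -
  have "(\<lambda>r. dens z (r, m)) \<in> borel_measurable (public_law \<pi>)" for m
  proof -
    have "Measurable.pred (public_law \<pi> \<Otimes>\<^sub>M private_law) (\<lambda>q. messages (tree \<pi> (fst q)) (fst z) (snd z) (fst (snd q)) (snd (snd q)) = m)"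
      using measurable_compose[OF measurable_messages[of "fst z" "snd z"], of "\<lambda>l. l = m" "count_space UNIV"]
      by (simp add: case_prod_beta')
    then have Q: "{q \<in> space (public_law \<pi> \<Otimes>\<^sub>M private_law). messages (tree \<pi> (fst q)) (fst z) (snd z) (fst (snd q)) (snd (snd q)) = m}
        \<in> sets (public_law \<pi> \<Otimes>\<^sub>M private_law)" (is "?Q \<in> _")
      by (rule predE)
    have "(\<lambda>r. measure private_law (Pair r -` ?Q)) \<in> borel_measurable (public_law \<pi>)"
      unfolding measure_def using AB.measurable_emeasure_Pair[OF Q] by measurable
    moreover have "dens z (r, m) = measure private_law (Pair r -` ?Q)" if "r \<in> space (public_law \<pi>)" for r
      unfolding dens_def by (rule arg_cong[where f = "measure private_law"])
        (use that in \<open>auto simp: space_pair_measure\<close>)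
    ultimately show ?thesis by (subst measurable_cong) auto
  qed
  then have "(\<lambda>x. dens z (fst x, snd x)) \<in> borel_measurable (public_law \<pi> \<Otimes>\<^sub>M count_space UNIV)"
    by (intro measurable_compose_countable'[where f = "\<lambda>m x. dens z (fst x, m)" and g = snd and I = UNIV])
      (auto intro: measurable_compose[OF measurable_fst])
  then show ?thesis by (simp add: transcript_space_def)
qed

lemma nn_integral_messages:
  assumes [measurable]: "G \<in> borel_measurable S"
  shows "(\<integral>\<^sup>+q. G (fst q, messages (tree \<pi> (fst q)) (fst z) (snd z) (fst (snd q)) (snd (snd q)))
      \<partial>(public_law \<pi> \<Otimes>\<^sub>M private_law)) = (\<integral>\<^sup>+x. ennreal (dens z x) * G x \<partial>S)"
proof -
  interpret C: sigma_finite_measure "count_space (UNIV :: bool list set)"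
    by (rule sigma_finite_measure_count_space)
  interpret pc: pair_sigma_finite "private_law" "count_space (UNIV :: bool list set)" ..
  have G[measurable]: "G \<in> borel_measurable (public_law \<pi> \<Otimes>\<^sub>M count_space UNIV)"
    using assms by (simp add: transcript_space_def)
  define msg where "msg = (\<lambda>r p. messages (tree \<pi> r) (fst z) (snd z) (fst p) (snd p))"
  have msg[measurable]: "(\<lambda>q. msg (fst q) (snd q)) \<in> public_law \<pi> \<Otimes>\<^sub>M private_law \<rightarrow>\<^sub>M count_space UNIV"
    using measurable_messages[of "fst z" "snd z"] by (simp add: msg_def case_prod_beta')
  \<comment> \<open>The integrand is expanded over all message lists against the indicator of the
    one actually sent; exchanging the integrals makes \<open>dens\<close> the weight of each
    list.\<close>
  have inner: "(\<integral>\<^sup>+p. G (r, msg r p) \<partial>private_law) = (\<integral>\<^sup>+m. ennreal (dens z (r, m)) * G (r, m) \<partial>count_space UNIV)"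
    if r: "r \<in> space (public_law \<pi>)" for r
  proof -
    have m[measurable]: "msg r \<in> private_law \<rightarrow>\<^sub>M count_space UNIV"
      unfolding msg_def by (rule measurable_messages_section[OF r])
    have "(\<integral>\<^sup>+p. G (r, msg r p) \<partial>private_law) = (\<integral>\<^sup>+p. \<integral>\<^sup>+m. G (r, m) * indicator {msg r p} m \<partial>count_space UNIV \<partial>private_law)"
      by simp
    also have "\<dots> = (\<integral>\<^sup>+m. \<integral>\<^sup>+p. G (r, m) * indicator {msg r p} m \<partial>private_law \<partial>count_space UNIV)"
    proof (rule pc.Fubini'[symmetric])
      have "(\<lambda>(p, m). G (r, m) * indicator {q. msg r (fst q) = snd q} (p, m)) \<in> borel_measurable (private_law \<Otimes>\<^sub>M count_space UNIV)"
        using r by measurable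
      then show "(\<lambda>(p, m). G (r, m) * indicator {msg r p} m) \<in> borel_measurable (private_law \<Otimes>\<^sub>M count_space UNIV)"
        by (simp add: indicator_def eq_commute case_prod_beta')
    qed
    also have "\<dots> = (\<integral>\<^sup>+m. ennreal (dens z (r, m)) * G (r, m) \<partial>count_space UNIV)"
    proof (rule nn_integral_cong)
      fix m
      have "(\<integral>\<^sup>+p. G (r, m) * indicator {msg r p} m \<partial>private_law)
          = (\<integral>\<^sup>+p. G (r, m) * indicator {p \<in> space private_law. msg r p = m} p \<partial>private_law)"
        by (intro nn_integral_cong) (auto simp: indicator_def)
      also have "\<dots> = G (r, m) * emeasure private_law {p \<in> space private_law. msg r p = m}"
        by (rule nn_integral_cmult_indicator) measurable
      finally show "(\<integral>\<^sup>+p. G (r, m) * indicator {msg r p} m \<partial>private_law) = ennreal (dens z (r, m)) * G (r, m)"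
        by (simp add: dens_def msg_def AB.emeasure_eq_measure mult.commute)
    qed
    finally show ?thesis .
  qed
  have "(\<integral>\<^sup>+q. G (fst q, msg (fst q) (snd q)) \<partial>(public_law \<pi> \<Otimes>\<^sub>M private_law))
      = (\<integral>\<^sup>+r. \<integral>\<^sup>+p. G (r, msg r p) \<partial>private_law \<partial>public_law \<pi>)"
    by (subst AB.nn_integral_fst[symmetric]) auto
  also have "\<dots> = (\<integral>\<^sup>+r. \<integral>\<^sup>+m. ennreal (dens z (r, m)) * G (r, m) \<partial>count_space UNIV \<partial>public_law \<pi>)"
    by (intro nn_integral_cong inner)
  also have "\<dots> = (\<integral>\<^sup>+x. ennreal (dens z x) * G x \<partial>S)"
    unfolding transcript_space_def
    by (rule C.nn_integral_fst) (use borel_measurable_dens[of z] in \<open>simp add: transcript_space_def\<close>)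
  finally show ?thesis by (simp add: msg_def)
qed

lemma nn_integral_dens: "(\<integral>\<^sup>+x. ennreal (dens z x) \<partial>S) = 1"
  using nn_integral_messages[of "\<lambda>_. 1" z] by (simp add: PAB.emeasure_space_1)

lemma integrable_dens [simp]: "integrable S (dens z)"
  by (rule integrableI_nonneg) (auto simp: nn_integral_dens)

lemma integral_dens [simp]: "integral\<^sup>L S (dens z) = 1"
  by (subst integral_eq_nn_integral) (auto simp: nn_integral_dens)

lemma measurable_transcript [measurable]: "transcript \<pi> \<in> \<Omega> \<rightarrow>\<^sub>M S"
proof -
  have "transcript \<pi> \<in> count_space UNIV \<Otimes>\<^sub>M (public_law \<pi> \<Otimes>\<^sub>M private_law) \<rightarrow>\<^sub>M S"
  proof (rule measurable_pair_measure_countable1)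
    fix z :: "'x \<times> 'y"
    have "(\<lambda>q. (fst q, messages (tree \<pi> (fst q)) (fst z) (snd z) (fst (snd q)) (snd (snd q)))) \<in> public_law \<pi> \<Otimes>\<^sub>M private_law \<rightarrow>\<^sub>M S"
      unfolding transcript_space_def
      using measurable_messages[of "fst z" "snd z"] by (intro measurable_Pair) (simp_all add: case_prod_beta')
    then show "(\<lambda>q. transcript \<pi> (z, q)) \<in> public_law \<pi> \<Otimes>\<^sub>M private_law \<rightarrow>\<^sub>M S"
      by (simp add: transcript_def case_prod_beta')
  qed simp
  then show ?thesis unfolding execution_def
    by (subst measurable_cong_sets[OF sets_pair_measure_cong[OF sets_measure_pmf_count_space refl] refl])
qed

lemma measurable_input [measurable]: "(\<lambda>\<omega>. k (fst \<omega>)) \<in> \<Omega> \<rightarrow>\<^sub>M count_space UNIV"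
proof -
  have "fst \<in> \<Omega> \<rightarrow>\<^sub>M measure_pmf D" unfolding execution_def by (rule measurable_fst)
  then show ?thesis by (rule measurable_compose) simp
qed

lemma expectation_D_eq_sum: "measure_pmf.expectation D h = (\<Sum>z\<in>set_pmf D. pmf D z * h z)" for h :: "_ \<Rightarrow> real"
  by (subst integral_measure_pmf_real[OF finite_support]) (auto simp: mult.commute)

section \<open>Joint law of transcript and input\<close>

lemma nn_integral_execution:
  assumes g[measurable]: "g \<in> borel_measurable (S \<Otimes>\<^sub>M count_space UNIV)"
  shows "(\<integral>\<^sup>+\<omega>. g (transcript \<pi> \<omega>, fst \<omega>) \<partial>\<Omega>) =
    (\<Sum>z\<in>set_pmf D. ennreal (pmf D z) * (\<integral>\<^sup>+x. ennreal (dens z x) * g (x, z) \<partial>S))"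
proof -
  have meas: "(\<lambda>\<omega>. g (transcript \<pi> \<omega>, fst \<omega>)) \<in> borel_measurable \<Omega>"
    using measurable_input[of "\<lambda>z. z"] by measurable
  have "(\<integral>\<^sup>+\<omega>. g (transcript \<pi> \<omega>, fst \<omega>) \<partial>\<Omega>) =
     (\<integral>\<^sup>+z. \<integral>\<^sup>+q. g (transcript \<pi> (z, q), z) \<partial>(public_law \<pi> \<Otimes>\<^sub>M private_law) \<partial>measure_pmf D)"
    using meas unfolding execution_def by (subst PAB.nn_integral_fst[symmetric]) auto
  also have "\<dots> = (\<integral>\<^sup>+z. (\<integral>\<^sup>+x. ennreal (dens z x) * g (x, z) \<partial>S) \<partial>measure_pmf D)"
  proof (rule nn_integral_cong)
    fix z
    show "(\<integral>\<^sup>+q. g (transcript \<pi> (z, q), z) \<partial>(public_law \<pi> \<Otimes>\<^sub>M private_law)) = (\<integral>\<^sup>+x. ennreal (dens z x) * g (x, z) \<partial>S)"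
      using nn_integral_messages[of "\<lambda>x. g (x, z)" z] by (simp add: transcript_def case_prod_beta')
  qed
  also have "\<dots> = (\<Sum>z\<in>set_pmf D. ennreal (pmf D z) * (\<integral>\<^sup>+x. ennreal (dens z x) * g (x, z) \<partial>S))"
    by (subst nn_integral_measure_pmf_finite[OF finite_support]) (auto intro!: sum.cong mult.commute)
  finally show ?thesis .
qed

text \<open>The density of the transcript for a random input.\<close>

definition mean :: "tape \<times> bool list \<Rightarrow> real" where
  "mean x = measure_pmf.expectation D (\<lambda>z. dens z x)"

lemma mean_nonneg [simp]: "0 \<le> mean x" by (simp add: mean_def)

lemma borel_measurable_expectation_D:
  fixes h :: "'x \<times> 'y \<Rightarrow> 'b \<Rightarrow> real"
  shows "(\<And>z. h z \<in> borel_measurable M) \<Longrightarrow> (\<lambda>x. measure_pmf.expectation D (\<lambda>z. h z x)) \<in> borel_measurable M"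
  unfolding expectation_D_eq_sum by measurable

lemma borel_measurable_mean [measurable]: "mean \<in> borel_measurable S"
  unfolding mean_def[abs_def] by (rule borel_measurable_expectation_D) measurable

lemma borel_measurable_cell_mass [measurable]:
  "(\<lambda>x. cell_mass D k (\<lambda>z. dens z x) y) \<in> borel_measurable S"
  unfolding cell_mass_def by (rule borel_measurable_expectation_D) measurable

lemma integrable_expectation_D:
  fixes h :: "'x \<times> 'y \<Rightarrow> 'b \<Rightarrow> real"
  assumes "\<And>z. integrable M (h z)"
  shows "integrable M (\<lambda>x. measure_pmf.expectation D (\<lambda>z. h z x))"
    "(\<integral>x. measure_pmf.expectation D (\<lambda>z. h z x) \<partial>M) = measure_pmf.expectation D (\<lambda>z. \<integral>x. h z x \<partial>M)"
  unfolding expectation_D_eq_sum using assms by simp_all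

lemma integrable_mean [simp]: "integrable S mean"
  unfolding mean_def[abs_def] by (rule integrable_expectation_D) simp

lemma distributed_transcript: "distributed \<Omega> S (transcript \<pi>) mean"
proof (rule distributed_realI)
  fix E assume [measurable]: "E \<in> sets S"
  have "(\<integral>\<^sup>+\<omega>. indicator E (transcript \<pi> \<omega>) \<partial>\<Omega>) =
      (\<Sum>z\<in>set_pmf D. ennreal (pmf D z) * (\<integral>\<^sup>+x. ennreal (dens z x) * indicator E x \<partial>S))"
    using nn_integral_execution[of "\<lambda>q. indicator E (fst q)"] by simp
  also have "\<dots> = (\<integral>\<^sup>+x. (\<Sum>z\<in>set_pmf D. ennreal (pmf D z) * (ennreal (dens z x) * indicator E x)) \<partial>S)"
    by (subst nn_integral_sum) (auto simp: nn_integral_cmult)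
  also have "\<dots> = (\<integral>\<^sup>+x. ennreal (mean x) * indicator E x \<partial>S)"
    by (intro nn_integral_cong)
      (simp add: mean_def expectation_D_eq_sum sum_ennreal[symmetric] ennreal_mult sum_distrib_right mult.assoc del: sum_ennreal)
  finally show "(\<integral>\<^sup>+\<omega>. indicator E (transcript \<pi> \<omega>) \<partial>\<Omega>) = (\<integral>\<^sup>+x. ennreal (mean x) * indicator E x \<partial>S)" .
qed measurable

lemma distributed_input:
  fixes k :: "'x \<times> 'y \<Rightarrow> 'c::countable"
  shows "distributed \<Omega> (count_space UNIV) (\<lambda>\<omega>. k (fst \<omega>)) (cell_prob D k)"
proof (rule distributed_realI)
  fix E :: "'c set"
  have "(\<integral>\<^sup>+\<omega>. indicator E (k (fst \<omega>)) \<partial>\<Omega>) = (\<Sum>z\<in>set_pmf D. ennreal (pmf D z) * indicator E (k z))"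
    using nn_integral_execution[of "\<lambda>q. indicator E (k (snd q))"]
    by (simp add: nn_integral_multc nn_integral_dens)
  also have "\<dots> = (\<integral>\<^sup>+y. (\<Sum>z\<in>set_pmf D. ennreal (pmf D z) * indicator E y * indicator {k z} y) \<partial>count_space UNIV)"
    by (subst nn_integral_sum) auto
  also have "\<dots> = (\<integral>\<^sup>+y. ennreal (cell_prob D k y) * indicator E y \<partial>count_space UNIV)"
    by (intro nn_integral_cong)
      (auto simp: cell_prob_def expectation_D_eq_sum sum_ennreal[symmetric] ennreal_mult sum_distrib_right
        indicator_def simp del: sum_ennreal intro!: sum.cong)
  finally show "(\<integral>\<^sup>+\<omega>. indicator E (k (fst \<omega>)) \<partial>\<Omega>) = (\<integral>\<^sup>+y. ennreal (cell_prob D k y) * indicator E y \<partial>count_space UNIV)" .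
qed measurable

lemma borel_measurable_joint [measurable]:
  fixes k :: "'x \<times> 'y \<Rightarrow> 'c::countable"
  shows "(\<lambda>q. cell_mass D k (\<lambda>z. dens z (fst q)) (snd q)) \<in> borel_measurable (S \<Otimes>\<^sub>M count_space UNIV)"
  by (rule measurable_compose_countable'[where f = "\<lambda>y q. cell_mass D k (\<lambda>z. dens z (fst q)) y" and g = snd and I = UNIV])
    (auto intro: measurable_compose[OF measurable_fst])

lemma distributed_joint:
  fixes k :: "'x \<times> 'y \<Rightarrow> 'c::countable"
  shows "distributed \<Omega> (S \<Otimes>\<^sub>M count_space UNIV) (\<lambda>\<omega>. (transcript \<pi> \<omega>, k (fst \<omega>)))
    (\<lambda>q. cell_mass D k (\<lambda>z. dens z (fst q)) (snd q))"
proof (rule distributed_realI)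
  interpret C: sigma_finite_measure "count_space (UNIV :: 'c set)"
    by (rule sigma_finite_measure_count_space)
  fix E assume E[measurable]: "E \<in> sets (S \<Otimes>\<^sub>M count_space (UNIV :: 'c set))"
  have [measurable]: "(\<lambda>q. (fst q, k (snd q))) \<in> S \<Otimes>\<^sub>M count_space UNIV \<rightarrow>\<^sub>M S \<Otimes>\<^sub>M count_space UNIV"
    by measurable
  have "(\<integral>\<^sup>+\<omega>. indicator E (transcript \<pi> \<omega>, k (fst \<omega>)) \<partial>\<Omega>) =
      (\<Sum>z\<in>set_pmf D. ennreal (pmf D z) * (\<integral>\<^sup>+x. ennreal (dens z x) * indicator E (x, k z) \<partial>S))"
    using nn_integral_execution[of "\<lambda>q. indicator E (fst q, k (snd q))"] by simp
  also have "\<dots> = (\<integral>\<^sup>+x. (\<Sum>z\<in>set_pmf D. ennreal (pmf D z) * (ennreal (dens z x) * indicator E (x, k z))) \<partial>S)"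
    by (subst nn_integral_sum) (auto simp: nn_integral_cmult)
  also have "\<dots> = (\<integral>\<^sup>+x. \<integral>\<^sup>+y. (\<Sum>z\<in>set_pmf D. ennreal (pmf D z) * (ennreal (dens z x) * indicator E (x, y)) * indicator {k z} y) \<partial>count_space UNIV \<partial>S)"
    by (intro nn_integral_cong) (subst nn_integral_sum, auto)
  also have "\<dots> = (\<integral>\<^sup>+x. \<integral>\<^sup>+y. ennreal (cell_mass D k (\<lambda>z. dens z x) y) * indicator E (x, y) \<partial>count_space UNIV \<partial>S)"
    by (intro nn_integral_cong)
      (auto simp: cell_mass_def expectation_D_eq_sum sum_ennreal[symmetric] ennreal_mult sum_distrib_right
        indicator_def simp del: sum_ennreal intro!: sum.cong)
  also have "\<dots> = (\<integral>\<^sup>+q. ennreal (cell_mass D k (\<lambda>z. dens z (fst q)) (snd q)) * indicator E q \<partial>(S \<Otimes>\<^sub>M count_space UNIV))"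
    by (subst C.nn_integral_fst[symmetric]) auto
  finally show "(\<integral>\<^sup>+\<omega>. indicator E (transcript \<pi> \<omega>, k (fst \<omega>)) \<partial>\<Omega>) =
     (\<integral>\<^sup>+q. ennreal (cell_mass D k (\<lambda>z. dens z (fst q)) (snd q)) * indicator E q \<partial>(S \<Otimes>\<^sub>M count_space UNIV))" .
qed measurable

end

section \<open>Information and posteriors in terms of the density\<close>

text \<open>The inputs have a countable type, but only finitely many values carry mass;
  integrability on each such section then suffices for Fubini.\<close>

lemma integral_pair_count_space:
  fixes f :: "'a \<times> 'c::countable \<Rightarrow> real"
  assumes "sigma_finite_measure M" and Y: "finite Y"
    and int: "\<And>y. y \<in> Y \<Longrightarrow> integrable M (\<lambda>x. f (x, y))"
    and supp: "\<And>x y. y \<notin> Y \<Longrightarrow> f (x, y) = 0"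
  shows "(\<integral>q. f q \<partial>(M \<Otimes>\<^sub>M count_space UNIV)) = (\<Sum>y\<in>Y. \<integral>x. f (x, y) \<partial>M)"
proof -
  interpret M: sigma_finite_measure M by fact
  interpret C: sigma_finite_measure "count_space (UNIV :: 'c set)"
    by (rule sigma_finite_measure_count_space)
  interpret pair_sigma_finite M "count_space (UNIV :: 'c set)" ..
  have inner: "(\<integral>y. h y \<partial>count_space UNIV) = sum h Y" "integrable (count_space UNIV) h"
    if h: "\<And>y. y \<notin> Y \<Longrightarrow> h y = 0" for h :: "'c \<Rightarrow> real"
  proof -
    have "finite {y. h y \<noteq> 0}" by (rule finite_subset[OF _ Y]) (use h in auto)
    then show "(\<integral>y. h y \<partial>count_space UNIV) = sum h Y"
      using h Y by (subst lebesgue_integral_count_space_finite_support) (auto intro!: sum.mono_neutral_left)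
    have "h = (\<lambda>y. \<Sum>z\<in>Y. h z * indicator {z} y)"
    proof
      fix y
      have "(\<Sum>z\<in>Y. h z * indicator {z} y) = (\<Sum>z\<in>Y. if z = y then h y else 0)"
        by (intro sum.cong) (auto simp: indicator_def)
      then show "h y = (\<Sum>z\<in>Y. h z * indicator {z} y)" using h Y by auto
    qed
    moreover have "integrable (count_space UNIV) (\<lambda>y. \<Sum>z\<in>Y. h z * indicator {z} y)"
      by (intro Bochner_Integration.integrable_sum integrable_mult_right integrable_real_indicator) auto
    ultimately show "integrable (count_space UNIV) h" by simp
  qed
  have slice: "(\<lambda>x. f (x, y)) \<in> borel_measurable M" for y
    using int[of y] supp[of y] by (cases "y \<in> Y") auto
  have "(\<lambda>q. f (fst q, snd q)) \<in> borel_measurable (M \<Otimes>\<^sub>M count_space UNIV)"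
    by (rule measurable_compose_countable'[where f = "\<lambda>y q. f (fst q, y)" and g = snd and I = UNIV])
      (auto intro: measurable_compose[OF measurable_fst] slice)
  then have f[measurable]: "f \<in> borel_measurable (M \<Otimes>\<^sub>M count_space UNIV)" by simp
  have "integrable (M \<Otimes>\<^sub>M count_space UNIV) f"
  proof (rule Fubini_integrable[OF f])
    have "(\<integral>y. norm (f (x, y)) \<partial>count_space UNIV) = (\<Sum>y\<in>Y. norm (f (x, y)))" for x
      by (rule inner) (simp add: supp)
    then show "integrable M (\<lambda>x. \<integral>y. norm (f (x, y)) \<partial>count_space UNIV)"
      using int by (simp only:) (auto intro!: Bochner_Integration.integrable_sum)
    show "AE x in M. integrable (count_space UNIV) (\<lambda>y. f (x, y))"
      by (intro AE_I2 inner supp)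
  qed
  from integral_fst'[OF this] have "(\<integral>q. f q \<partial>(M \<Otimes>\<^sub>M count_space UNIV)) = (\<integral>x. (\<integral>y. f (x, y) \<partial>count_space UNIV) \<partial>M)"
    by simp
  also have "\<dots> = (\<integral>x. (\<Sum>y\<in>Y. f (x, y)) \<partial>M)"
    by (intro Bochner_Integration.integral_cong refl inner supp)
  also have "\<dots> = (\<Sum>y\<in>Y. \<integral>x. f (x, y) \<partial>M)"
    by (intro Bochner_Integration.integral_sum int)
  finally show ?thesis .
qed

context protocol_run
begin

lemma cell_mass_dens:
  shows "0 \<le> cell_mass D k (\<lambda>z. dens z x) y" "cell_mass D k (\<lambda>z. dens z x) y \<le> mean x"
  unfolding cell_mass_def mean_def expectation_D_eq_sum
  by (auto intro!: sum_nonneg sum_mono mult_left_mono)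

lemma sum_cell_mass: "(\<Sum>y\<in>k ` set_pmf D. cell_mass D k (\<lambda>z. dens z x) y) = mean x"
proof -
  have "(\<Sum>y\<in>k ` set_pmf D. cell_mass D k (\<lambda>z. dens z x) y)
     = (\<Sum>z\<in>set_pmf D. \<Sum>y\<in>k ` set_pmf D. pmf D z * (of_bool (k z = y) * dens z x))"
    unfolding cell_mass_def expectation_D_eq_sum by (rule sum.swap)
  also have "\<dots> = mean x"
    unfolding mean_def expectation_D_eq_sum
    by (intro sum.cong refl) (simp add: finite_support of_bool_def if_distrib if_distribR sum.delta cong: if_cong)
  finally show ?thesis .
qed

lemma cell_prob_pos: "y \<in> k ` set_pmf D \<Longrightarrow> 0 < cell_prob D k y"
  unfolding cell_prob_def expectation_D_eq_sum
  by (auto intro!: sum_pos2[OF finite_support] simp: pmf_positive)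

lemma cell_prob_bounds: "0 \<le> cell_prob D k y" "cell_prob D k y \<le> 1"
  unfolding cell_prob_def
  by (simp, rule measure_pmf.integral_le_const) (auto intro!: integrable_measure_pmf_finite finite_support)

text \<open>The two summands of the integrand need not be integrable separately.\<close>
lemma mutual_information_transcript:
  fixes k :: "'x \<times> 'y \<Rightarrow> 'c::countable"
  shows "integrable S (\<lambda>x. ent_given D k (\<lambda>z. dens z x) - xlnx (mean x))" (is ?int)
    and "\<Omega>.mutual_information 2 S (count_space UNIV) (transcript \<pi>) (\<lambda>\<omega>. k (fst \<omega>)) =
      (\<integral>x. ent_given D k (\<lambda>z. dens z x) - xlnx (mean x) \<partial>S) / ln 2" (is ?eq)
proof -
  interpret info: information_space \<Omega> 2 by standard simp
  define u where "u = (\<lambda>y x. cell_mass D k (\<lambda>z. dens z x) y)"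
  define p where "p = cell_prob D k"
  define Y where "Y = k ` set_pmf D"
  \<comment> \<open>The integrand, in nats, of the relative entropy of the joint law with respect to
    the product law.\<close>
  define f where "f = (\<lambda>q. u (snd q) (fst q) * ln (u (snd q) (fst q) / (mean (fst q) * p (snd q))))"
  have Y: "finite Y" using finite_support by (simp add: Y_def)
  have p: "0 < p y" "p y \<le> 1" if "y \<in> Y" for y
    using that cell_prob_pos[of y k] by (simp_all add: p_def Y_def cell_prob_bounds)
  have u: "0 \<le> u y x" "u y x \<le> mean x" for x y
    by (simp_all add: u_def cell_mass_dens)
  have [measurable]: "u y \<in> borel_measurable S" for y
    unfolding u_def by measurable
  have u0: "u y x = 0" if "y \<notin> Y" for x y
    unfolding u_def cell_mass_def expectation_D_eq_sum
    by (rule sum.neutral) (use that in \<open>auto simp: Y_def\<close>)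
  have f_eq: "f (x, y) = p y * xlnx (u y x / p y) - u y x * ln (mean x)" if "y \<in> Y" for x y
  proof (cases "u y x = 0")
    case False
    then have "0 < u y x" "0 < mean x" "0 < p y" using u[of y x] p[OF that] by auto
    then show ?thesis by (simp add: f_def xlnx_def ln_div ln_mult algebra_simps)
  qed (simp add: f_def)
  \<comment> \<open>Below, the tangent at ratio 1; above, \<open>u y x\<close> is at most
    \<open>mean x\<close>. Hence a multiple of the integrable \<open>mean\<close> dominates, even
    when the transcript has infinite entropy.\<close>
  have f_bound: "\<bar>f (x, y)\<bar> \<le> (1 - ln (p y)) * mean x" if "y \<in> Y" for x y
  proof (cases "u y x = 0")
    case True
    moreover have "0 \<le> (1 - ln (p y)) * mean x"
      using p[OF that] by (intro mult_nonneg_nonneg) (simp_all add: order_trans[of _ 0])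
    ultimately show ?thesis by (simp add: f_def)
  next
    case False
    then have pos: "0 < u y x" "0 < mean x" "0 < p y" using u[of y x] p[OF that] by auto
    have lnp: "ln (p y) \<le> 0" using p[OF that] by simp
    have "u y x - mean x * p y \<le> f (x, y)"
      using mult_ln_ratio_ge[of "u y x" "mean x * p y" 1] pos by (simp add: f_def)
    moreover have "mean x * p y \<le> mean x" using p[OF that] pos by (intro mult_left_le) auto
    ultimately have "- mean x \<le> f (x, y)" using pos by linarith
    moreover have "f (x, y) \<le> - ln (p y) * mean x"
    proof -
      have "u y x / (mean x * p y) \<le> 1 / p y" using u[of y x] pos by (simp add: field_simps)
      then have "ln (u y x / (mean x * p y)) \<le> ln (1 / p y)" using pos by (intro ln_mono) auto
      then have "f (x, y) \<le> u y x * ln (1 / p y)" using u by (simp add: f_def mult_left_mono)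
      also have "\<dots> = - ln (p y) * u y x" using pos by (simp add: ln_div)
      also have "\<dots> \<le> - ln (p y) * mean x" using lnp u by (intro mult_left_mono) auto
      finally show ?thesis .
    qed
    moreover have "0 \<le> - ln (p y) * mean x" using lnp by (simp add: mult_nonpos_nonneg)
    ultimately show ?thesis using pos by (simp add: algebra_simps abs_le_iff)
  qed
  have int_f: "integrable S (\<lambda>x. f (x, y))" if "y \<in> Y" for y
  proof (rule Bochner_Integration.integrable_bound)
    show "integrable S (\<lambda>x. (1 - ln (p y)) * mean x)" by simp
    show "(\<lambda>x. f (x, y)) \<in> borel_measurable S" unfolding f_def fst_conv snd_conv by measurable
    show "AE x in S. norm (f (x, y)) \<le> norm ((1 - ln (p y)) * mean x)"
      using f_bound[OF that] by (intro AE_I2) (metis abs_ge_self order_trans real_norm_def)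
  qed
  have sum_f: "(\<Sum>y\<in>Y. f (x, y)) = ent_given D k (\<lambda>z. dens z x) - xlnx (mean x)" for x
  proof -
    have "(\<Sum>y\<in>Y. f (x, y)) = (\<Sum>y\<in>Y. p y * xlnx (u y x / p y)) - (\<Sum>y\<in>Y. u y x) * ln (mean x)"
      by (simp add: f_eq sum_subtractf sum_distrib_right)
    also have "(\<Sum>y\<in>Y. u y x) = mean x"
      unfolding u_def Y_def by (rule sum_cell_mass)
    finally show ?thesis by (simp add: ent_given_def u_def Y_def p_def xlnx_def)
  qed
  have "integrable S (\<lambda>x. \<Sum>y\<in>Y. f (x, y))" by (intro Bochner_Integration.integrable_sum int_f)
  then show ?int by (simp add: sum_f)
  have "\<Omega>.mutual_information 2 S (count_space UNIV) (transcript \<pi>) (\<lambda>\<omega>. k (fst \<omega>)) =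
     (\<integral>q. u (snd q) (fst q) * log 2 (u (snd q) (fst q) / (mean (fst q) * p (snd q))) \<partial>(S \<Otimes>\<^sub>M count_space UNIV))"
    unfolding u_def p_def
    by (rule info.mutual_information_distr[OF sigma_finite_S sigma_finite_measure_count_space
          distributed_transcript _ distributed_input _ distributed_joint])
      (auto simp: cell_mass_dens cell_prob_bounds)
  also have "\<dots> = (\<integral>q. f q / ln 2 \<partial>(S \<Otimes>\<^sub>M count_space UNIV))"
    by (simp add: f_def log_def)
  also have "\<dots> = (\<integral>q. f q \<partial>(S \<Otimes>\<^sub>M count_space UNIV)) / ln 2" by simp
  also have "(\<integral>q. f q \<partial>(S \<Otimes>\<^sub>M count_space UNIV)) = (\<Sum>y\<in>Y. \<integral>x. f (x, y) \<partial>S)"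
    by (rule integral_pair_count_space[OF sigma_finite_S Y int_f]) (auto simp: f_def u0)
  also have "\<dots> = (\<integral>x. (\<Sum>y\<in>Y. f (x, y)) \<partial>S)"
    by (intro Bochner_Integration.integral_sum[symmetric] int_f)
  finally show ?eq by (simp add: sum_f)
qed

text \<open>Each conditional information is the information about the input pair minus that about
  the conditioning input. The pair appears once in each order, both covered by
  \<open>ent_given_inj\<close>, and the \<open>xlnx (mean x)\<close> terms cancel.\<close>

lemma internal_ic_eq:
  "integrable S (\<lambda>x. 2 * measure_pmf.expectation D (\<lambda>z. xlnx (dens z x))
      - ent_given D snd (\<lambda>z. dens z x) - ent_given D fst (\<lambda>z. dens z x))" (is ?int)
  "internal_ic \<pi> D = (\<integral>x. 2 * measure_pmf.expectation D (\<lambda>z. xlnx (dens z x))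
      - ent_given D snd (\<lambda>z. dens z x) - ent_given D fst (\<lambda>z. dens z x) \<partial>S) / ln 2" (is ?eq)
proof -
  define G where "G = (\<lambda>x. measure_pmf.expectation D (\<lambda>z. xlnx (dens z x)) - xlnx (mean x))"
  define G1 where "G1 = (\<lambda>x. ent_given D fst (\<lambda>z. dens z x) - xlnx (mean x))"
  define G2 where "G2 = (\<lambda>x. ent_given D snd (\<lambda>z. dens z x) - xlnx (mean x))"
  have id: "ent_given D (\<lambda>z. z) (\<lambda>z. dens z x) = measure_pmf.expectation D (\<lambda>z. xlnx (dens z x))"
    "ent_given D prod.swap (\<lambda>z. dens z x) = measure_pmf.expectation D (\<lambda>z. xlnx (dens z x))" for x
    by (intro ent_given_inj finite_support; auto simp: inj_on_def)+
  have int: "integrable S G" "integrable S G1" "integrable S G2"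
    using mutual_information_transcript(1)[of "\<lambda>z. z"] mutual_information_transcript(1)[of fst]
      mutual_information_transcript(1)[of snd]
    by (simp_all add: G_def G1_def G2_def id)
  have eq: "2 * measure_pmf.expectation D (\<lambda>z. xlnx (dens z x))
      - ent_given D snd (\<lambda>z. dens z x) - ent_given D fst (\<lambda>z. dens z x) = 2 * G x - G1 x - G2 x" for x
    by (simp add: G_def G1_def G2_def)
  show ?int unfolding eq using int by simp
  have pair: "count_space (UNIV :: 'a set) \<Otimes>\<^sub>M count_space (UNIV :: 'b set) = count_space (UNIV :: ('a \<times> 'b) set)"
    for t :: "'a::countable" and s :: "'b::countable"
    by (subst pair_measure_countable) auto
  have mi: "\<Omega>.mutual_information 2 S (count_space UNIV) (transcript \<pi>) (\<lambda>\<omega>. (alice_input \<omega>, bob_input \<omega>)) = (\<integral>x. G x \<partial>S) / ln 2"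
    "\<Omega>.mutual_information 2 S (count_space UNIV) (transcript \<pi>) (\<lambda>\<omega>. (bob_input \<omega>, alice_input \<omega>)) = (\<integral>x. G x \<partial>S) / ln 2"
    "\<Omega>.mutual_information 2 S (count_space UNIV) (transcript \<pi>) alice_input = (\<integral>x. G1 x \<partial>S) / ln 2"
    "\<Omega>.mutual_information 2 S (count_space UNIV) (transcript \<pi>) bob_input = (\<integral>x. G2 x \<partial>S) / ln 2"
    using mutual_information_transcript(2)[of "\<lambda>z. z"] mutual_information_transcript(2)[of prod.swap]
      mutual_information_transcript(2)[of fst] mutual_information_transcript(2)[of snd]
    by (simp_all add: G_def G1_def G2_def id alice_input_def[abs_def] bob_input_def[abs_def] prod.swap_def)
  show ?eq
    unfolding internal_ic_def \<Omega>.conditional_mutual_information_def pair mi eq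
    using int by (simp add: diff_divide_distrib add_divide_distrib)
qed

section \<open>Posterior of a function of the input\<close>

lemma integral_transcript:
  fixes G :: "_ \<Rightarrow> real"
  assumes "G \<in> borel_measurable S"
  shows "(\<integral>\<omega>. G (transcript \<pi> \<omega>) \<partial>\<Omega>) = (\<integral>x. mean x * G x \<partial>S)"
  by (rule distributed_integral[OF distributed_transcript assms, symmetric]) simp

text \<open>Bayes' rule. The events generated by the transcript are preimages of sets in
  \<open>S\<close>, and on them both sides reduce to integrals of densities.\<close>

lemma cond_exp_transcript:
  fixes k :: "'x \<times> 'y \<Rightarrow> 'c::countable"
  shows "AE \<omega> in \<Omega>. real_cond_exp \<Omega> (vimage_algebra (space \<Omega>) (transcript \<pi>) S) (indicator {\<omega>'. k (fst \<omega>') = y}) \<omega>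
    = cell_mass D k (\<lambda>z. dens z (transcript \<pi> \<omega>)) y / mean (transcript \<pi> \<omega>)"
proof -
  define F where "F = vimage_algebra (space \<Omega>) (transcript \<pi>) S"
  define u where "u = (\<lambda>x. cell_mass D k (\<lambda>z. dens z x) y)"
  define g where "g = (\<lambda>\<omega>. u (transcript \<pi> \<omega>) / mean (transcript \<pi> \<omega>))"
  have tr: "transcript \<pi> \<in> space \<Omega> \<rightarrow> space S"
    using measurable_transcript by (auto simp: measurable_def)
  have "subalgebra \<Omega> F"
    unfolding subalgebra_def F_def using sets_image_in_sets[OF refl measurable_transcript] by simp
  then interpret F: finite_measure_subalgebra \<Omega> F by unfold_locales
  have u: "0 \<le> u x" "u x \<le> mean x" for x
    by (simp_all add: u_def cell_mass_dens)
  have [measurable]: "u \<in> borel_measurable S" unfolding u_def by measurable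
  have u_int: "integrable S u"
    by (rule Bochner_Integration.integrable_bound[OF integrable_mean]) (use u in auto)
  have k_sets: "{\<omega> \<in> space \<Omega>. k (fst \<omega>) = y} \<in> sets \<Omega>"
    using measurable_sets_Collect[OF measurable_input[of k], of "\<lambda>v. v = y"] by simp
  have ind_int: "integrable \<Omega> (indicator {\<omega>'. k (fst \<omega>') = y} :: _ \<Rightarrow> real)"
  proof -
    have "integrable \<Omega> (indicator {\<omega> \<in> space \<Omega>. k (fst \<omega>) = y} :: _ \<Rightarrow> real)"
      using k_sets by (intro integrable_real_indicator) (auto simp: \<Omega>.emeasure_eq_measure)
    then show ?thesis
      by (subst Bochner_Integration.integrable_cong[OF refl, where g = "indicator {\<omega> \<in> space \<Omega>. k (fst \<omega>) = y}"])
        (auto simp: indicator_def)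
  qed
  have "AE \<omega> in \<Omega>. real_cond_exp \<Omega> F (indicator {\<omega>'. k (fst \<omega>') = y}) \<omega> = g \<omega>"
  proof (rule F.real_cond_exp_charact)
    fix A assume "A \<in> sets F"
    then obtain E where E[measurable]: "E \<in> sets S" and A: "A = transcript \<pi> -` E \<inter> space \<Omega>"
      unfolding F_def sets_vimage_algebra2[OF tr] by auto
    have "(\<integral>\<omega>\<in>A. (indicator {\<omega>'. k (fst \<omega>') = y} \<omega> :: real) \<partial>\<Omega>)
        = (\<integral>\<omega>. indicator E (transcript \<pi> \<omega>) * indicator {y} (k (fst \<omega>)) \<partial>\<Omega>)"
      unfolding set_lebesgue_integral_def
      by (intro Bochner_Integration.integral_cong) (auto simp: A indicator_def)
    also have "\<dots> = (\<integral>q. cell_mass D k (\<lambda>z. dens z (fst q)) (snd q) * (indicator E (fst q) * indicator {y} (snd q)) \<partial>(S \<Otimes>\<^sub>M count_space UNIV))"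
      using distributed_integral[OF distributed_joint[of k], of "\<lambda>q. indicator E (fst q) * indicator {y} (snd q)"]
      by (simp add: cell_mass_dens)
    also have "\<dots> = (\<integral>x. u x * indicator E x \<partial>S)"
    proof -
      have "integrable S (\<lambda>x. u x * indicator E x)"
        by (intro integrable_real_mult_indicator u_int) measurable
      then show ?thesis
        by (subst integral_pair_count_space[OF sigma_finite_S, of "{y}"]) (auto simp: u_def)
    qed
    also have "\<dots> = (\<integral>x. mean x * (indicator E x * (u x / mean x)) \<partial>S)"
    proof (intro Bochner_Integration.integral_cong refl)
      fix x
      \<comment> \<open>Where \<open>mean\<close> vanishes so does \<open>u\<close>, so the value 0
        of the quotient there does no harm.\<close>
      show "u x * indicator E x = mean x * (indicator E x * (u x / mean x))"
        using u[of x] by (cases "mean x = 0") auto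
    qed
    also have "\<dots> = (\<integral>\<omega>. indicator E (transcript \<pi> \<omega>) * (u (transcript \<pi> \<omega>) / mean (transcript \<pi> \<omega>)) \<partial>\<Omega>)"
      by (rule integral_transcript[symmetric]) measurable
    also have "\<dots> = (\<integral>\<omega>\<in>A. g \<omega> \<partial>\<Omega>)"
      unfolding set_lebesgue_integral_def
      by (intro Bochner_Integration.integral_cong) (auto simp: A g_def indicator_def)
    finally show "(\<integral>\<omega>\<in>A. indicator {\<omega>'. k (fst \<omega>') = y} \<omega> \<partial>\<Omega>) = (\<integral>\<omega>\<in>A. g \<omega> \<partial>\<Omega>)" .
  next
    show "integrable \<Omega> (indicator {\<omega>'. k (fst \<omega>') = y} :: _ \<Rightarrow> real)" by (rule ind_int)
    show "integrable \<Omega> g"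
      by (rule \<Omega>.integrable_const_bound[where B = 1]) (use u in \<open>auto simp: g_def divide_le_eq_1 less_le\<close>)
    have "transcript \<pi> \<in> F \<rightarrow>\<^sub>M S" unfolding F_def by (rule measurable_vimage_algebra1[OF tr])
    then show "g \<in> borel_measurable F" unfolding g_def by measurable
  qed
  then show ?thesis by (simp add: F_def g_def u_def)
qed

end

section \<open>The lower bound\<close>

lemma integral_avg_disj:
  fixes f :: "'a \<Rightarrow> bool list \<Rightarrow> bool list \<Rightarrow> real"
  assumes "\<And>a b. integrable M (\<lambda>x. f x a b)"
  shows "integrable M (\<lambda>x. avg_disj n (f x))"
    "(\<integral>x. avg_disj n (f x) \<partial>M) = avg_disj n (\<lambda>a b. \<integral>x. f x a b \<partial>M)"
proof -
  have "integrable M (\<lambda>x. avg_disj n (f x)) \<and>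
      (\<integral>x. avg_disj n (f x) \<partial>M) = avg_disj n (\<lambda>a b. \<integral>x. f x a b \<partial>M)"
    using assms
  proof (induction n arbitrary: f)
    case 0
    then show ?case by (simp add: avg_disj_0)
  next
    case (Suc n)
    show ?case unfolding avg_disj_Suc
      using Suc.IH[of "\<lambda>x a b. f x (c # a) (d # b)" for c d] Suc.prems by simp
  qed
  then show "integrable M (\<lambda>x. avg_disj n (f x))"
    "(\<integral>x. avg_disj n (f x) \<partial>M) = avg_disj n (\<lambda>a b. \<integral>x. f x a b \<partial>M)" by auto
qed

lemma integral_cut_term:
  fixes f :: "'a \<Rightarrow> bool list \<Rightarrow> bool list \<Rightarrow> real"
  assumes "\<And>a b. integrable M (\<lambda>x. f x a b)"
  shows "integrable M (\<lambda>x. cut_term n (f x))"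
    "(\<integral>x. cut_term n (f x) \<partial>M) = cut_term n (\<lambda>a b. \<integral>x. f x a b \<partial>M)"
proof -
  have "integrable M (\<lambda>x. cut_term n (f x)) \<and>
      (\<integral>x. cut_term n (f x) \<partial>M) = cut_term n (\<lambda>a b. \<integral>x. f x a b \<partial>M)"
    using assms
  proof (induction n arbitrary: f)
    case (Suc n)
    have sl: "integrable M (\<lambda>x. slice c d (f x) a b)" for c d a b
      by (simp add: slice_def Suc.prems)
    have mix: "integrable M (\<lambda>x. slice_mix (f x) a b)" for a b
      by (simp add: slice_mix_def sl)
    have sl_eq: "(\<lambda>a b. \<integral>x. slice c d (f x) a b \<partial>M) = slice c d (\<lambda>a b. \<integral>x. f x a b \<partial>M)" for c d
      by (simp add: slice_def fun_eq_iff)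
    have mix_eq: "(\<lambda>a b. \<integral>x. slice_mix (f x) a b \<partial>M) = slice_mix (\<lambda>a b. \<integral>x. f x a b \<partial>M)"
      by (simp add: slice_mix_def fun_eq_iff sl, simp add: slice_def)
    note IH1 = Suc.IH[of "\<lambda>x. slice_mix (f x)", OF mix]
      and IH2 = Suc.IH[of "\<lambda>x. slice True False (f x)", OF sl]
      and avg = integral_avg_disj[of M "\<lambda>x. slice c d (f x)" n for c d, OF sl]
    show ?case
      using IH1 IH2 avg by (simp add: sl_eq mix_eq)
  qed simp
  then show "integrable M (\<lambda>x. cut_term n (f x))"
    "(\<integral>x. cut_term n (f x) \<partial>M) = cut_term n (\<lambda>a b. \<integral>x. f x a b \<partial>M)" by auto
qed

text \<open>Every input's transcript density has total mass 1, so integration replaces the matrix by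
  a constant one. There the four masses cancel, which is how the correction disappears.\<close>

lemma cut_term_const: "cut_term n (\<lambda>a b. c) = 0"
proof (induction n)
  case (Suc n)
  have "slice u v (\<lambda>a b. c) = (\<lambda>a b. c)" "slice_mix (\<lambda>a b. c) = (\<lambda>a b. c)" for u v
    by (simp_all add: slice_mix_def slice_def fun_eq_iff)
  then show ?case by (simp add: Suc)
qed simp

lemma set_int_information:
  fixes \<pi> :: "(bool list, bool list) protocol"
  assumes n: "1 \<le> n" and \<epsilon>: "0 \<le> \<epsilon>" and \<pi>: "is_protocol \<pi>" and solves: "solves_set_int \<pi> n \<epsilon>"
  shows "\<epsilon>\<^sup>2 * n / 96 \<le> internal_ic \<pi> (D_SI n)"
proof -
  interpret protocol_run \<pi> "D_SI n"
    by unfold_locales (use \<pi> n finite_set_D_SI in auto)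
  define f where "f = (\<lambda>x a b. dens (a, b) x)"
  define \<nu> where "\<nu> = (\<lambda>t x. avg_disj n (plant t (f x)))"
  have f_plant: "integrable S (\<lambda>x. plant t (f x) a b)" "(\<integral>x. plant t (f x) a b \<partial>S) = 1" for t a b
    by (simp_all add: plant_def f_def)
  have \<nu>_int [simp]: "integrable S (\<nu> t)" and \<nu>_1: "(\<integral>x. \<nu> t x \<partial>S) = 1" for t
    unfolding \<nu>_def using integral_avg_disj[of S "\<lambda>x. plant t (f x)" n, OF f_plant(1)]
    by (simp_all add: f_plant(2) avg_disj_const)
  have cut_int: "integrable S (\<lambda>x. cut_term n (plant t (f x)))"
    and cut_0: "(\<integral>x. cut_term n (plant t (f x)) \<partial>S) = 0" for t
    using integral_cut_term[of S "\<lambda>x. plant t (f x)" n, OF f_plant(1)]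
    by (simp_all add: f_plant(2) cut_term_const)
  have \<nu>_nonneg [simp]: "0 \<le> \<nu> t x" for t x
    by (simp add: \<nu>_def avg_disj_nonneg plant_def f_def)
  have [measurable]: "\<nu> t \<in> borel_measurable S" for t
    using \<nu>_int by (rule borel_measurable_integrable)
  have hell_int: "integrable S (\<lambda>x. hell (\<nu> s x) (\<nu> t x))" for s t
  proof (rule Bochner_Integration.integrable_bound)
    show "integrable S (\<lambda>x. \<nu> s x + \<nu> t x)" by simp
    show "(\<lambda>x. hell (\<nu> s x) (\<nu> t x)) \<in> borel_measurable S" unfolding hell_def by measurable
    show "AE x in S. norm (hell (\<nu> s x) (\<nu> t x)) \<le> norm (\<nu> s x + \<nu> t x)"
    proof (rule AE_I2)
      fix x
      have "hell (\<nu> s x) (\<nu> t x) \<le> \<nu> s x + \<nu> t x" by (simp add: hell_expand)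
      then show "norm (hell (\<nu> s x) (\<nu> t x)) \<le> norm (\<nu> s x + \<nu> t x)" by simp
    qed
  qed
  \<comment> \<open>Up to the factor \<open>n\<^sup>2\<close> the mean squared Hellinger distance
    between the transcript laws of two random targets. It bounds the information from below and the
    squared bias of the posterior from above.\<close>
  define W where "W = (\<Sum>s<n. \<Sum>t<n. \<integral>x. hell (\<nu> s x) (\<nu> t x) \<partial>S)"
  have W_nonneg: "0 \<le> W" unfolding W_def by (intro sum_nonneg integral_nonneg) simp

  have info: "W / (96 * n) \<le> internal_ic \<pi> (D_SI n)"
  proof -
    let ?J = "\<lambda>x. 2 * measure_pmf.expectation (D_SI n) (\<lambda>z. xlnx (dens z x))
      - ent_given (D_SI n) snd (\<lambda>z. dens z x) - ent_given (D_SI n) fst (\<lambda>z. dens z x)"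
    \<comment> \<open>Subtracting the cut terms, whose integrals are zero, makes the integrand lie
      below \<open>?J\<close> at every transcript.\<close>
    have "W / (96 * n) = (\<integral>x. (\<Sum>s<n. \<Sum>t<n. hell (\<nu> s x) (\<nu> t x)) / (96 * n)
        - (\<Sum>t<n. cut_term n (plant t (f x))) / n \<partial>S)"
      by (simp add: W_def hell_int cut_int cut_0)
    also have "\<dots> \<le> (\<integral>x. ?J x \<partial>S)"
    proof (rule integral_mono)
      show "integrable S (\<lambda>x. (\<Sum>s<n. \<Sum>t<n. hell (\<nu> s x) (\<nu> t x)) / (96 * n)
        - (\<Sum>t<n. cut_term n (plant t (f x))) / n)"
        by (simp add: hell_int cut_int)
      show "integrable S ?J" by (rule internal_ic_eq(1))
      fix x assume "x \<in> space S"
      then show "(\<Sum>s<n. \<Sum>t<n. hell (\<nu> s x) (\<nu> t x)) / (96 * n)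
        - (\<Sum>t<n. cut_term n (plant t (f x))) / n \<le> ?J x"
        using set_int_info_lower_bound[OF n, of "f x"] dens_rectangle[of x]
        by (simp add: f_def \<nu>_def)
    qed
    finally have J: "W / (96 * n) \<le> (\<integral>x. ?J x \<partial>S)" .
    \<comment> \<open>The passage from nats to bits only enlarges the bound.\<close>
    have "ln 2 \<le> (1::real)" using ln_le_minus_one[of "2::real"] by simp
    moreover have "0 \<le> W / (96 * n)" using W_nonneg by simp
    ultimately have "W / (96 * n) * ln 2 \<le> W / (96 * n)"
      by (intro mult_left_le) auto
    with J show ?thesis by (simp add: internal_ic_eq(2) pos_le_divide_eq)
  qed

  define q where "q = (\<lambda>t x. \<nu> t x / n)"
  have cell_q: "cell_mass (D_SI n) (\<lambda>z. target (fst z) (snd z)) (\<lambda>z. dens z x) t = q t x" if "t < n" for t x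
    unfolding cell_mass_def q_def \<nu>_def
    using expectation_D_SI_target[OF n that, of "f x"] by (simp add: f_def)
  have mean_eq: "mean x = (\<Sum>t<n. \<nu> t x) / n" for x
    unfolding mean_def \<nu>_def using expectation_D_SI[OF n, of "f x"] by (simp add: f_def)
  have target_ae: "AE \<omega> in \<Omega>. \<forall>t\<in>{..<n}. target_dist \<pi> n \<omega> t = q t (transcript \<pi> \<omega>) / mean (transcript \<pi> \<omega>)"
  proof (rule AE_finite_allI)
    fix t assume t: "t \<in> {..<n}"
    show "AE \<omega> in \<Omega>. target_dist \<pi> n \<omega> t = q t (transcript \<pi> \<omega>) / mean (transcript \<pi> \<omega>)"
      using cond_exp_transcript[of "\<lambda>z. target (fst z) (snd z)" t] t
      by (simp add: target_dist_def cell_q alice_input_def bob_input_def)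
  qed simp
  have abs_int: "integrable S (\<lambda>x. \<bar>\<nu> s x - \<nu> t x\<bar>)" for s t by simp
  have "\<epsilon> \<le> (\<integral>\<omega>. tvd {..<n} (target_dist \<pi> n \<omega>) (pmf (pmf_of_set {..<n})) \<partial>\<Omega>)"
    using solves by (simp add: solves_set_int_def)
  also have "\<dots> = (\<integral>\<omega>. (\<Sum>t<n. \<bar>q t (transcript \<pi> \<omega>) / mean (transcript \<pi> \<omega>) - 1 / n\<bar>) / 2 \<partial>\<Omega>)"
  proof (rule integral_cong_AE)
    show "(\<lambda>\<omega>. tvd {..<n} (target_dist \<pi> n \<omega>) (pmf (pmf_of_set {..<n}))) \<in> borel_measurable \<Omega>"
      unfolding tvd_def target_dist_def by measurable
    show "(\<lambda>\<omega>. (\<Sum>t<n. \<bar>q t (transcript \<pi> \<omega>) / mean (transcript \<pi> \<omega>) - 1 / n\<bar>) / 2) \<in> borel_measurable \<Omega>"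
      unfolding q_def by measurable
    show "AE \<omega> in \<Omega>. tvd {..<n} (target_dist \<pi> n \<omega>) (pmf (pmf_of_set {..<n})) =
        (\<Sum>t<n. \<bar>q t (transcript \<pi> \<omega>) / mean (transcript \<pi> \<omega>) - 1 / n\<bar>) / 2"
      using target_ae
    proof eventually_elim
      case (elim \<omega>)
      have "{..<n} \<noteq> {}" using n lessThan_empty_iff[of n] by (simp add: bot_nat_def)
      then show ?case unfolding tvd_def using elim
        by (intro arg_cong[where f = "\<lambda>x. x / 2"] sum.cong) auto
    qed
  qed
  also have "\<dots> = (\<integral>x. mean x * ((\<Sum>t<n. \<bar>q t x / mean x - 1 / n\<bar>) / 2) \<partial>S)"
    by (rule integral_transcript) (simp add: q_def)
  also have "\<dots> \<le> (\<integral>x. (\<Sum>t<n. \<Sum>s<n. \<bar>\<nu> s x - \<nu> t x\<bar>) / (2 * n\<^sup>2) \<partial>S)"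
  proof (rule integral_mono_AE')
    show "integrable S (\<lambda>x. (\<Sum>t<n. \<Sum>s<n. \<bar>\<nu> s x - \<nu> t x\<bar>) / (2 * n\<^sup>2))" by simp
    show "AE x in S. 0 \<le> (\<Sum>t<n. \<Sum>s<n. \<bar>\<nu> s x - \<nu> t x\<bar>) / (2 * n\<^sup>2)"
      by (intro AE_I2 divide_nonneg_nonneg sum_nonneg) auto
    show "AE x in S. mean x * ((\<Sum>t<n. \<bar>q t x / mean x - 1 / n\<bar>) / 2) \<le> (\<Sum>t<n. \<Sum>s<n. \<bar>\<nu> s x - \<nu> t x\<bar>) / (2 * n\<^sup>2)"
    proof (rule AE_I2)
      fix x
      have "mean x * \<bar>q t x / mean x - 1 / n\<bar> \<le> (\<Sum>s<n. \<bar>\<nu> s x - \<nu> t x\<bar>) / n\<^sup>2" if t: "t < n" for t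
      proof -
        have "q t x \<le> mean x"
          using cell_mass_dens(2)[of "\<lambda>z. target (fst z) (snd z)" x t] cell_q[OF t] by simp
        moreover have "0 \<le> q t x" by (simp add: q_def)
        ultimately have "mean x * (q t x / mean x - 1 / n) = q t x - mean x / n"
          by (cases "mean x = 0") (auto simp: right_diff_distrib)
        then have "mean x * \<bar>q t x / mean x - 1 / n\<bar> = \<bar>q t x - mean x / n\<bar>"
          by (metis abs_mult abs_of_nonneg mean_nonneg)
        \<comment> \<open>With a uniform prior the bias of the posterior at \<open>t\<close> is the
          deviation of \<open>\<nu> t\<close> from the average of all \<open>\<nu> s\<close>, so
          pairwise differences bound it.\<close>
        also have "q t x - mean x / n = (\<Sum>s<n. \<nu> t x - \<nu> s x) / n\<^sup>2"
          using n by (simp add: q_def mean_eq sum_subtractf field_simps power2_eq_square)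
        also have "\<bar>\<dots>\<bar> \<le> (\<Sum>s<n. \<bar>\<nu> s x - \<nu> t x\<bar>) / n\<^sup>2"
          unfolding abs_divide abs_power2 abs_of_nat
          using sum_abs[of "\<lambda>s. \<nu> t x - \<nu> s x" "{..<n}"]
          by (intro divide_right_mono) (auto simp: abs_minus_commute)
        finally show ?thesis .
      qed
      then have "(\<Sum>t<n. mean x * \<bar>q t x / mean x - 1 / n\<bar>) \<le> (\<Sum>t<n. (\<Sum>s<n. \<bar>\<nu> s x - \<nu> t x\<bar>) / n\<^sup>2)"
        by (intro sum_mono) auto
      then have "mean x * (\<Sum>t<n. \<bar>q t x / mean x - 1 / n\<bar>) \<le> (\<Sum>t<n. \<Sum>s<n. \<bar>\<nu> s x - \<nu> t x\<bar>) / n\<^sup>2"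
        by (simp only: sum_distrib_left sum_divide_distrib)
      from divide_right_mono[OF this, of 2] show "mean x * ((\<Sum>t<n. \<bar>q t x / mean x - 1 / n\<bar>) / 2) \<le> (\<Sum>t<n. \<Sum>s<n. \<bar>\<nu> s x - \<nu> t x\<bar>) / (2 * n\<^sup>2)"
        by (simp add: mult.commute)
    qed
  qed
  also have "\<dots> = (\<Sum>t<n. \<Sum>s<n. \<integral>x. \<bar>\<nu> s x - \<nu> t x\<bar> \<partial>S) / (2 * n\<^sup>2)"
    by (simp add: Bochner_Integration.integral_sum)
  finally have \<epsilon>_le: "\<epsilon> \<le> (\<Sum>t<n. \<Sum>s<n. \<integral>x. \<bar>\<nu> s x - \<nu> t x\<bar> \<partial>S) / (2 * n\<^sup>2)" .
  have "\<epsilon>\<^sup>2 \<le> W / n\<^sup>2"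
  proof (cases "\<epsilon> = 0")
    case True
    then show ?thesis using W_nonneg by simp
  next
    case False
    \<comment> \<open>This choice makes the linear part of \<open>abs_diff_le_hell\<close>
      contribute exactly \<open>\<epsilon> / 2\<close>, which the left-hand side absorbs.\<close>
    define k where "k = \<epsilon> / 2"
    have k: "0 < k" using False \<epsilon> by (simp add: k_def)
    have "(\<integral>x. \<bar>\<nu> s x - \<nu> t x\<bar> \<partial>S) \<le> (\<integral>x. hell (\<nu> s x) (\<nu> t x) \<partial>S) / (2 * k) + 2 * k" for s t
    proof -
      have "(\<integral>x. \<bar>\<nu> s x - \<nu> t x\<bar> \<partial>S) \<le> (\<integral>x. hell (\<nu> s x) (\<nu> t x) / (2 * k) + k * (\<nu> s x + \<nu> t x) \<partial>S)"
        by (intro integral_mono) (auto simp: hell_int abs_diff_le_hell k)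
      also have "\<dots> = (\<integral>x. hell (\<nu> s x) (\<nu> t x) \<partial>S) / (2 * k) + 2 * k"
        by (simp add: hell_int \<nu>_1)
      finally show ?thesis .
    qed
    then have "(\<Sum>t<n. \<Sum>s<n. \<integral>x. \<bar>\<nu> s x - \<nu> t x\<bar> \<partial>S) \<le> (\<Sum>t<n. \<Sum>s<n. (\<integral>x. hell (\<nu> s x) (\<nu> t x) \<partial>S) / (2 * k) + 2 * k)"
      by (intro sum_mono)
    also have "\<dots> = W / (2 * k) + n\<^sup>2 * (2 * k)"
    proof -
      have "(\<Sum>t<n. \<Sum>s<n. \<integral>x. hell (\<nu> s x) (\<nu> t x) \<partial>S) = W"
        unfolding W_def by (rule sum.swap)
      then show ?thesis
        by (simp add: sum.distrib power2_eq_square flip: sum_divide_distrib)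
    qed
    finally have "(\<Sum>t<n. \<Sum>s<n. \<integral>x. \<bar>\<nu> s x - \<nu> t x\<bar> \<partial>S) / (2 * n\<^sup>2) \<le> (W / (2 * k) + n\<^sup>2 * (2 * k)) / (2 * n\<^sup>2)"
      by (rule divide_right_mono) simp
    with \<epsilon>_le have "\<epsilon> \<le> (W / (2 * k) + n\<^sup>2 * (2 * k)) / (2 * n\<^sup>2)" by (rule order_trans)
    also have "\<dots> = W / n\<^sup>2 / (2 * \<epsilon>) + \<epsilon> / 2"
      using n k by (simp add: k_def field_simps)
    finally have "\<epsilon> / 2 \<le> W / n\<^sup>2 / (2 * \<epsilon>)" by linarith
    then have "\<epsilon> / 2 * (2 * \<epsilon>) \<le> W / n\<^sup>2"
      using k by (subst (asm) pos_le_divide_eq) (auto simp: k_def)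
    then show ?thesis by (simp add: power2_eq_square)
  qed
  then have "\<epsilon>\<^sup>2 * n / 96 \<le> W / n\<^sup>2 * n / 96"
    by (intro divide_right_mono mult_right_mono) auto
  also have "\<dots> = W / (96 * n)" using n by (simp add: power2_eq_square)
  also note info
  finally show ?thesis .
qed

theorem theorem4p4:
  "\<exists>c::real. c > 0 \<and>
     (\<forall>(n::nat) (\<epsilon>::real) (\<pi>::(bool list, bool list) protocol).
        n \<ge> 1 \<longrightarrow> \<epsilon> \<ge> 0 \<longrightarrow> is_protocol \<pi> \<longrightarrow> solves_set_int \<pi> n \<epsilon> \<longrightarrow>
        internal_ic \<pi> (D_SI n) \<ge> c * \<epsilon>\<^sup>2 * real n)"
proof (intro exI[of _ "1/96 :: real"] conjI allI impI)
  fix n :: nat and \<epsilon> :: real and \<pi> :: "(bool list, bool list) protocol"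
  assume "n \<ge> 1" "\<epsilon> \<ge> 0" "is_protocol \<pi>" "solves_set_int \<pi> n \<epsilon>"
  then show "1 / 96 * \<epsilon>\<^sup>2 * real n \<le> internal_ic \<pi> (D_SI n)"
    using set_int_information[of n \<epsilon> \<pi>] by simp
qed simp

end
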